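(* Let $G$ be an infinite systolic group, i.e. an infinite finitely generated group which acts properly and cocompactly by simplicial automorphisms on some systolic simplicial complex $X$. Then $G$ contains an element of infinite order.
   Context: Simplicial complexes are not assumed finite dimensional or locally finite, and are equipped with the CW topology. A simplicial complex is flag if every finite set of vertices pairwise connected by edges spans a simplex. A cycle is a subcomplex homeomorphic to $S^1$; its length is its number of edges. A diagonal of a cycle is an edge (of the ambient complex) connecting two nonconsecutive vertices of the cycle. The link $X_v$ of a vertex $v$ is the subcomplex of all simplices that do not contain $v$ but together with $v$ span a simplex of $X$. For $k\ge 4$, a simplicial complex is $k$-large if it is flag and every cycle of length $m$ with $4\le m<k$ has a diagonal; it is locally $k$-large if the links of all its vertices are $k$-large. A simplicial complex is $k$-systolic if it is locally $k$-large, connected (in particular nonempty) and simply connected. "Systolic" means $6$-systolic. An action of $G$ on a topological space $X$ is proper if for every compact $K\subset X$ the set $\{g\in G \mid gK\cap K\neq\emptyset\}$ is finite, and cocompact if there is a compact $K\subset X$ with $X=GK$. *)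

theory Defs
  imports
    "HOL-Analysis.Analysis"
    "HOL-Algebra.Group_Action"
    "HOL-Algebra.Generated_Groups"
begin

section \<open>Simplicial complexes and their geometric realization\<close>

text \<open>A complex is given by its set of (nonempty) simplices, each of them identified with its
  set of vertices; no dimension or local finiteness bound is imposed. The vertex set is
  \<open>\<Union>X\<close>. The empty complex is allowed, since links may be empty.\<close>

definition simplicial_complex :: "'v set set \<Rightarrow> bool" where
  "simplicial_complex X \<longleftrightarrow>
     (\<forall>s\<in>X. finite s \<and> s \<noteq> {}) \<and>
     (\<forall>s\<in>X. \<forall>t. t \<subseteq> s \<and> t \<noteq> {} \<longrightarrow> t \<in> X)"

definition edges :: "'v set set \<Rightarrow> 'v set set" where
  "edges X = {e \<in> X. card e = 2}"

text \<open>Points are described by barycentric coordinates.\<close>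

definition geometric_simplex :: "'v set \<Rightarrow> ('v \<Rightarrow> real) set" where
  "geometric_simplex s = {t. (\<forall>v. 0 \<le> t v) \<and> (\<forall>v. v \<notin> s \<longrightarrow> t v = 0) \<and> sum t s = 1}"

text \<open>The CW (weak) topology: a set is open iff it meets every simplex in a relatively open set.
  A single simplex carries the topology of pointwise convergence of the coordinates; as only
  finitely many coordinates are nonzero on it, this is its Euclidean topology.\<close>

definition geometric_realization :: "'v set set \<Rightarrow> ('v \<Rightarrow> real) topology" where
  "geometric_realization X = topology (\<lambda>U. U \<subseteq> (\<Union>s\<in>X. geometric_simplex s) \<and>
     (\<forall>s\<in>X. openin (top_of_set (geometric_simplex s)) (U \<inter> geometric_simplex s)))"

lemma openin_geometric_realization:
  "openin (geometric_realization X) U \<longleftrightarrow> U \<subseteq> (\<Union>s\<in>X. geometric_simplex s) \<and>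
     (\<forall>s\<in>X. openin (top_of_set (geometric_simplex s)) (U \<inter> geometric_simplex s))"
proof -
  let ?P = "\<lambda>U. U \<subseteq> (\<Union>s\<in>X. geometric_simplex s) \<and>
     (\<forall>s\<in>X. openin (top_of_set (geometric_simplex s)) (U \<inter> geometric_simplex s))"
  have "istopology ?P"
    unfolding istopology_def
  proof (intro conjI allI impI)
    fix S T assume S: "?P S" and T: "?P T"
    show "S \<inter> T \<subseteq> (\<Union>s\<in>X. geometric_simplex s)" using S by blast
    show "\<forall>s\<in>X. openin (top_of_set (geometric_simplex s)) (S \<inter> T \<inter> geometric_simplex s)"
    proof
      fix s assume "s \<in> X"
      have "S \<inter> T \<inter> geometric_simplex s = (S \<inter> geometric_simplex s) \<inter> (T \<inter> geometric_simplex s)"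
        by blast
      then show "openin (top_of_set (geometric_simplex s)) (S \<inter> T \<inter> geometric_simplex s)"
        using S T \<open>s \<in> X\<close> by (simp add: openin_Int)
    qed
  next
    fix \<K> assume K: "\<forall>K\<in>\<K>. ?P K"
    show "\<Union>\<K> \<subseteq> (\<Union>s\<in>X. geometric_simplex s)" using K by blast
    show "\<forall>s\<in>X. openin (top_of_set (geometric_simplex s)) (\<Union>\<K> \<inter> geometric_simplex s)"
    proof
      fix s assume "s \<in> X"
      have "\<Union>\<K> \<inter> geometric_simplex s = \<Union>((\<lambda>K. K \<inter> geometric_simplex s) ` \<K>)"
        by blast
      then show "openin (top_of_set (geometric_simplex s)) (\<Union>\<K> \<inter> geometric_simplex s)"
        using K \<open>s \<in> X\<close> by (simp only:) (rule openin_Union, blast)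
    qed
  qed
  then show ?thesis
    by (simp add: geometric_realization_def topology_inverse')
qed

lemma topspace_geometric_realization:
  "topspace (geometric_realization X) = (\<Union>s\<in>X. geometric_simplex s)"
proof
  show "topspace (geometric_realization X) \<subseteq> (\<Union>s\<in>X. geometric_simplex s)"
    using openin_geometric_realization openin_topspace by blast
  have "(\<Union>s\<in>X. geometric_simplex s) \<inter> geometric_simplex s = geometric_simplex s" if "s \<in> X" for s
    using that by blast
  then have "openin (geometric_realization X) (\<Union>s\<in>X. geometric_simplex s)"
    by (simp add: openin_geometric_realization)
  then show "(\<Union>s\<in>X. geometric_simplex s) \<subseteq> topspace (geometric_realization X)"
    by (rule openin_subset)
qed

section \<open>Systolic complexes\<close>

definition flag_complex :: "'v set set \<Rightarrow> bool" where
  "flag_complex X \<longleftrightarrow>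
     (\<forall>s. finite s \<and> s \<noteq> {} \<and> s \<subseteq> \<Union>X \<and> (\<forall>u\<in>s. \<forall>v\<in>s. u \<noteq> v \<longrightarrow> {u, v} \<in> edges X) \<longrightarrow> s \<in> X)"

definition cycle_in :: "'v set set \<Rightarrow> 'v set set \<Rightarrow> bool" where
  "cycle_in X C \<longleftrightarrow> C \<subseteq> X \<and> simplicial_complex C \<and>
     geometric_realization C homeomorphic_space top_of_set (sphere (0::complex) 1)"

text \<open>For a cycle the set of edges is finite, by compactness of the circle, so that \<open>card\<close>
  gives the true number of edges.\<close>

definition cycle_length :: "'v set set \<Rightarrow> nat" where
  "cycle_length C = card (edges C)"

text \<open>Two distinct vertices of a cycle are consecutive iff they are joined by an edge of
  the cycle.\<close>

definition is_diagonal :: "'v set set \<Rightarrow> 'v set set \<Rightarrow> 'v set \<Rightarrow> bool" where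
  "is_diagonal X C e \<longleftrightarrow> e \<in> edges X \<and> e \<subseteq> \<Union>C \<and> e \<notin> edges C"

definition link :: "'v set set \<Rightarrow> 'v \<Rightarrow> 'v set set" where
  "link X v = {s \<in> X. v \<notin> s \<and> insert v s \<in> X}"

text \<open>The following notions are meant for \<open>k \<ge> 4\<close>.\<close>

definition k_large :: "nat \<Rightarrow> 'v set set \<Rightarrow> bool" where
  "k_large k X \<longleftrightarrow> flag_complex X \<and>
     (\<forall>C. cycle_in X C \<and> 4 \<le> cycle_length C \<and> cycle_length C < k \<longrightarrow> (\<exists>e. is_diagonal X C e))"

definition locally_k_large :: "nat \<Rightarrow> 'v set set \<Rightarrow> bool" where
  "locally_k_large k X \<longleftrightarrow> (\<forall>v\<in>\<Union>X. k_large k (link X v))"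

text \<open>The library's \<open>simply_connected\<close> is restricted to subsets of a type of class
  \<open>topological_space\<close>. The homotopies below are relative to the endpoints.\<close>

definition simply_connected_space :: "'a topology \<Rightarrow> bool" where
  "simply_connected_space T \<longleftrightarrow> path_connected_space T \<and>
     (\<forall>p x. pathin T p \<and> p 0 = x \<and> p 1 = x \<longrightarrow>
        homotopic_with (\<lambda>q. q 0 = x \<and> q 1 = x) (top_of_set {0..1}) T p (\<lambda>_. x))"

definition k_systolic :: "nat \<Rightarrow> 'v set set \<Rightarrow> bool" where
  "k_systolic k X \<longleftrightarrow> simplicial_complex X \<and> locally_k_large k X \<and>
     X \<noteq> {} \<and> connected_space (geometric_realization X) \<and>
     simply_connected_space (geometric_realization X)"

abbreviation systolic :: "'v set set \<Rightarrow> bool" where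
  "systolic X \<equiv> k_systolic 6 X"

section \<open>Group actions\<close>

definition simplicial_automorphism :: "'v set set \<Rightarrow> ('v \<Rightarrow> 'v) \<Rightarrow> bool" where
  "simplicial_automorphism X f \<longleftrightarrow> bij_betw f (\<Union>X) (\<Union>X) \<and> (\<lambda>s. f ` s) ` X = X"

definition simplicial_action ::
    "('g, 'm) monoid_scheme \<Rightarrow> 'v set set \<Rightarrow> ('g \<Rightarrow> 'v \<Rightarrow> 'v) \<Rightarrow> bool" where
  "simplicial_action G X \<phi> \<longleftrightarrow> group_action G (\<Union>X) \<phi> \<and>
     (\<forall>g\<in>carrier G. simplicial_automorphism X (\<phi> g))"

text \<open>The extension of a vertex map to the realization, affine on each simplex.\<close>

definition affine_extension :: "('v \<Rightarrow> 'w) \<Rightarrow> ('v \<Rightarrow> real) \<Rightarrow> ('w \<Rightarrow> real)" where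
  "affine_extension f t = (\<lambda>w. \<Sum>v | t v \<noteq> 0 \<and> f v = w. t v)"

definition proper_action ::
    "('g, 'm) monoid_scheme \<Rightarrow> 'a topology \<Rightarrow> ('g \<Rightarrow> 'a \<Rightarrow> 'a) \<Rightarrow> bool" where
  "proper_action G T \<psi> \<longleftrightarrow>
     (\<forall>K. compactin T K \<longrightarrow> finite {g \<in> carrier G. \<psi> g ` K \<inter> K \<noteq> {}})"

definition cocompact_action ::
    "('g, 'm) monoid_scheme \<Rightarrow> 'a topology \<Rightarrow> ('g \<Rightarrow> 'a \<Rightarrow> 'a) \<Rightarrow> bool" where
  "cocompact_action G T \<psi> \<longleftrightarrow>
     (\<exists>K. compactin T K \<and> topspace T = (\<Union>g\<in>carrier G. \<psi> g ` K))"

definition finitely_generated_group :: "('g, 'm) monoid_scheme \<Rightarrow> bool" where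
  "finitely_generated_group G \<longleftrightarrow> group G \<and>
     (\<exists>S. finite S \<and> S \<subseteq> carrier G \<and> generate G S = carrier G)"

end

theory Submission
  imports Defs
begin

text \<open>
  Fix a base vertex. The universal cover of the 2-skeleton of a locally 6-large complex is built
  sphere by sphere: a new vertex over \<open>x\<close> is a class of boundary vertices \<open>w\<close> whose link contains
  \<open>x\<close> as a not yet lifted vertex, and the absence of short cycles in links makes the identification
  transitive. By construction every clique of the \<open>(n+1)\<close>-sphere of the cover has a nonempty clique
  of common neighbours in the \<open>n\<close>-sphere. As the complex is simply connected, the cover is the
  complex itself, which therefore has this projection property.

  Iterated projection of a vertex towards the base vertex gives a directed geodesic, a sequence of
  simplices characterised by a condition on triples of consecutive members; conversely, by the
  projection property, a sequence of simplices that starts at the base vertex and satisfies this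
  local condition moves away from the base vertex at unit speed. In a long directed geodesic two
  consecutive pairs of simplices are translates of each other under some \<open>g\<close>, because the action
  is proper and cocompact. The periodic continuation of the segment between them is again a directed
  geodesic, so no positive power of \<open>g\<close> is trivial.
\<close>

section \<open>Topology of the geometric realization\<close>

text \<open>Nothing global is known about the complex at the outset, so distances are hard to
  control inside it. They are controlled in the cover, where the level of a vertex is part of the
  construction, and are carried back once simple connectivity has made the projection injective. The
  bound 6 is what the construction consumes: comparing new edges produces closed walks of length at
  most 5 in links, and everything else is settled by triangles and 4-cycles. The complex may a
  priori be infinite dimensional and locally infinite; local finiteness is extracted from the
  action. Finding a single simplex repeated up to translation would not be enough for a periodic
  continuation, because the local condition involves three consecutive members. A repeated pair is
  enough: every triple of the continuation is then a translate of a triple of the original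
  geodesic.\<close>

lemma closed_geometric_simplex:
  assumes "finite s" shows "closed (geometric_simplex s)"
proof -
  have c: "continuous_on UNIV (\<lambda>t :: 'a \<Rightarrow> real. t v)" for v
    by (rule continuous_on_product_coordinates)
  have "geometric_simplex s = {t. \<forall>v. 0 \<le> t v} \<inter> {t. \<forall>v. v \<notin> s \<longrightarrow> t v = 0} \<inter> {t. sum t s = 1}"
    by (auto simp: geometric_simplex_def)
  also have "closed \<dots>"
    by (intro closed_Int closed_Collect_all closed_Collect_imp closed_Collect_le closed_Collect_eq
        continuous_on_sum c continuous_on_const open_Collect_const)
  finally show ?thesis .
qed

text \<open>On finitely many simplices the CW topology is no finer than pointwise convergence: the
  part of their union outside an open set is a finite union of closed sets.\<close>

lemma continuous_into_realization:
  assumes K: "finite K" "K \<subseteq> X" "\<And>s. s \<in> K \<Longrightarrow> finite s"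
    and f: "continuous_map T euclidean f" "\<And>x. x \<in> topspace T \<Longrightarrow> f x \<in> (\<Union>s\<in>K. geometric_simplex s)"
  shows "continuous_map T (geometric_realization X) f"
  unfolding continuous_map_def
proof (intro conjI allI impI)
  show "f \<in> topspace T \<rightarrow> topspace (geometric_realization X)"
    using f(2) K(2) by (fastforce simp: topspace_geometric_realization)
  fix U assume U: "openin (geometric_realization X) U"
  have "closed (geometric_simplex s - U)" if "s \<in> K" for s
  proof -
    have "openin (top_of_set (geometric_simplex s)) (U \<inter> geometric_simplex s)"
      using U K that by (auto simp: openin_geometric_realization)
    then obtain V where "open V" "U \<inter> geometric_simplex s = geometric_simplex s \<inter> V"
      by (auto simp: openin_open)
    then have "geometric_simplex s - U = geometric_simplex s - V" by blast
    then show ?thesis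
      using closed_Diff[OF closed_geometric_simplex \<open>open V\<close>] K(3)[OF that] by simp
  qed
  then have "closed (\<Union>s\<in>K. geometric_simplex s - U)" using K by blast
  then have "closedin euclidean (\<Union>s\<in>K. geometric_simplex s - U)" by simp
  then have "closedin T {x \<in> topspace T. f x \<in> (\<Union>s\<in>K. geometric_simplex s - U)}"
    by (rule closedin_continuous_map_preimage[OF f(1)])
  moreover have "{x \<in> topspace T. f x \<in> U} =
      topspace T - {x \<in> topspace T. f x \<in> (\<Union>s\<in>K. geometric_simplex s - U)}"
    using f(2) by blast
  ultimately show "openin T {x \<in> topspace T. f x \<in> U}" by auto
qed

definition vertex_point :: "'v \<Rightarrow> 'v \<Rightarrow> real" where
  "vertex_point v = (\<lambda>u. if u = v then 1 else 0)"

lemma vertex_point_mem: "finite s \<Longrightarrow> v \<in> s \<Longrightarrow> vertex_point v \<in> geometric_simplex s"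
  by (auto simp: vertex_point_def geometric_simplex_def)

text \<open>The set is the open star of \<open>v\<close>. Open stars cover the realization, and
  vertices whose open stars share a point span a simplex (\<open>support_simplex\<close>); the
  homotopy and the connectedness arguments rest on these two facts.\<close>

lemma openin_star: "openin (geometric_realization X) {t \<in> topspace (geometric_realization X). t v \<noteq> 0}"
  unfolding openin_geometric_realization
proof (intro conjI ballI)
  show "{t \<in> topspace (geometric_realization X). t v \<noteq> 0} \<subseteq> (\<Union>s\<in>X. geometric_simplex s)"
    by (auto simp: topspace_geometric_realization)
  fix s assume s: "s \<in> X"
  have "open {t :: 'a \<Rightarrow> real. t v \<noteq> 0}"
    by (intro open_Collect_neq continuous_on_product_coordinates continuous_on_const)
  moreover have "{t \<in> topspace (geometric_realization X). t v \<noteq> 0} \<inter> geometric_simplex s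
      = geometric_simplex s \<inter> {t. t v \<noteq> 0}"
    using s by (auto simp: topspace_geometric_realization)
  ultimately show "openin (top_of_set (geometric_simplex s))
     ({t \<in> topspace (geometric_realization X). t v \<noteq> 0} \<inter> geometric_simplex s)"
    by (metis openin_open)
qed

lemma simplex_face:
  assumes "simplicial_complex X" "s \<in> X" "t \<subseteq> s" "t \<noteq> {}"
  shows "t \<in> X"
proof -
  have "\<forall>s\<in>X. \<forall>t. t \<subseteq> s \<and> t \<noteq> {} \<longrightarrow> t \<in> X"
    using assms(1) unfolding simplicial_complex_def by (rule conjunct2)
  from bspec[OF this assms(2)] show ?thesis using assms(3,4) by (elim allE[of _ t]) simp
qed

lemma support_simplex:
  assumes "simplicial_complex X" "t \<in> topspace (geometric_realization X)"
    "S \<subseteq> {v. t v \<noteq> 0}" "S \<noteq> {}"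
  shows "S \<in> X"
proof -
  obtain s where "s \<in> X" "t \<in> geometric_simplex s"
    using assms(2) by (auto simp: topspace_geometric_realization)
  then have "S \<subseteq> s" using assms(3) by (auto simp: geometric_simplex_def)
  then show ?thesis using simplex_face[OF assms(1) \<open>s \<in> X\<close> _ assms(4)] by simp
qed

lemma support_nonempty:
  assumes "t \<in> topspace (geometric_realization X)" shows "\<exists>v. t v \<noteq> 0"
proof (rule ccontr)
  assume "\<nexists>v. t v \<noteq> 0"
  then have "t = (\<lambda>_. 0)" by blast
  then show False using assms by (auto simp: topspace_geometric_realization geometric_simplex_def)
qed

section \<open>Piecewise linear paths and subdivided homotopies\<close>

definition hat :: "real \<Rightarrow> real" where "hat y = max 0 (1 - \<bar>y\<bar>)"

text \<open>The path through \<open>v 0\<close>, ..., \<open>v n\<close> at the times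
  \<open>k / n\<close>, linear in between. As a finite sum of tent functions it is visibly
  continuous; consecutive vertices may coincide.\<close>

definition edge_path :: "nat \<Rightarrow> (nat \<Rightarrow> 'v) \<Rightarrow> real \<Rightarrow> 'v \<Rightarrow> real" where
  "edge_path n v s = (\<lambda>u. \<Sum>i\<le>n. hat (n * s - i) * vertex_point (v i) u)"

lemma edge_path_segment:
  fixes s :: real
  assumes "real k \<le> n * s" "n * s \<le> real k + 1" "k < n"
  shows "edge_path n v s =
    (\<lambda>u. (1 - (n * s - k)) * vertex_point (v k) u + (n * s - k) * vertex_point (v (Suc k)) u)"
proof
  fix u
  have z: "hat (n * s - i) = 0" if i: "i \<noteq> k" "i \<noteq> Suc k" for i :: nat
  proof -
    consider "i < k" | "i > Suc k" using i by linarith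
    then have "\<bar>n * s - i\<bar> \<ge> 1" using assms(1,2) by cases auto
    then show ?thesis by (simp add: hat_def)
  qed
  have "edge_path n v s u = (\<Sum>i\<in>{k, Suc k}. hat (n * s - i) * vertex_point (v i) u)"
    unfolding edge_path_def using z assms(3) by (intro sum.mono_neutral_right) auto
  moreover have "hat (n * s - k) = 1 - (n * s - k)" "hat (n * s - Suc k) = n * s - k"
    using assms(1,2) by (auto simp: hat_def)
  ultimately show "edge_path n v s u =
     (1 - (n * s - k)) * vertex_point (v k) u + (n * s - k) * vertex_point (v (Suc k)) u" by simp
qed

lemma segment_exists:
  fixes n :: nat and s :: real
  assumes "0 \<le> s" "s \<le> 1" "0 < n"
  obtains k where "k < n" "real k \<le> n * s" "n * s \<le> real k + 1"
proof (cases "s = 1")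
  case True
  \<comment> \<open>The floor of \<open>n * s\<close> would give the index \<open>n\<close> here, at
    which no segment starts.\<close>
  then show ?thesis using that[of "n - 1"] assms by auto
next
  case False
  then have "n * s < n" using assms by simp
  then have "nat \<lfloor>n * s\<rfloor> < n" using assms by (simp add: nat_less_iff floor_less_iff)
  moreover have "real (nat \<lfloor>n * s\<rfloor>) = of_int \<lfloor>n * s\<rfloor>" using assms by simp
  ultimately show ?thesis using that[of "nat \<lfloor>n * s\<rfloor>"] by linarith
qed

lemma edge_path_support:
  fixes s :: real
  assumes "k < n" "real k \<le> n * s" "n * s \<le> real k + 1" "edge_path n v s u \<noteq> 0"
  shows "u = v k \<or> u = v (Suc k)"
  using assms(4) unfolding edge_path_segment[OF assms(2,3,1)]
  by (auto simp: vertex_point_def split: if_splits)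

lemma edge_path_node:
  fixes s :: real
  assumes "k \<le> n" "0 < n" "real n * s = real k"
  shows "edge_path n v s = vertex_point (v k)"
proof (cases "k < n")
  case True
  then show ?thesis using edge_path_segment[of k n s v] assms by simp
next
  case False
  then obtain l where l: "k = Suc l" using assms by (cases k) auto
  then show ?thesis using edge_path_segment[of l n s v] assms by simp
qed

lemma edge_path_in_simplex:
  fixes s :: real
  assumes "k < n" "real k \<le> n * s" "n * s \<le> real k + 1"
  shows "edge_path n v s \<in> geometric_simplex {v k, v (Suc k)}"
proof -
  have "sum (edge_path n v s) {v k, v (Suc k)} = 1"
    unfolding edge_path_segment[OF assms(2,3,1)]
    by (cases "v k = v (Suc k)") (auto simp: vertex_point_def)
  moreover have "0 \<le> edge_path n v s u" for u
    unfolding edge_path_segment[OF assms(2,3,1)] using assms(2,3) by (simp add: vertex_point_def)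
  moreover have "edge_path n v s u = 0" if "u \<notin> {v k, v (Suc k)}" for u
    using edge_path_support[OF assms, of v u] that by auto
  ultimately show ?thesis by (auto simp: geometric_simplex_def)
qed

lemma continuous_edge_path: "continuous_on S (edge_path n v)"
proof (rule continuous_on_coordinatewise_then_product)
  show "continuous_on S (\<lambda>s. edge_path n v s u)" for u
    unfolding edge_path_def hat_def by (intro continuous_intros)
qed

lemma pathin_edge_path:
  assumes "0 < n" "\<And>k. k < n \<Longrightarrow> {v k, v (Suc k)} \<in> X"
  shows "pathin (geometric_realization X) (edge_path n v)"
  unfolding pathin_def
proof (rule continuous_into_realization[where K = "(\<lambda>k. {v k, v (Suc k)}) ` {..<n}"])
  show "continuous_map (top_of_set {0..1}) euclidean (edge_path n v)"
    using continuous_edge_path by (simp add: continuous_map_iff_continuous)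
  fix s :: real assume "s \<in> topspace (top_of_set {0..1})"
  then obtain k where "k < n" "real k \<le> n * s" "n * s \<le> real k + 1"
    using segment_exists[of s n] assms(1) by auto
  then show "edge_path n v s \<in> (\<Union>s\<in>(\<lambda>k. {v k, v (Suc k)}) ` {..<n}. geometric_simplex s)"
    using edge_path_in_simplex[of k n s v] by auto
qed (use assms in auto)

text \<open>The homotopy square is subdivided so finely that every small square is mapped into the open
  star of a vertex, which becomes the label of the square.\<close>
lemma grid_labels:
  fixes n :: nat
  assumes h: "continuous_map (prod_topology (top_of_set {0..1::real}) (top_of_set {0..1::real}))
      (geometric_realization X) h"
    and n: "0 < n"
  obtains m :: nat and v where "0 < m"
    "\<And>i j a b. \<lbrakk>i < n * m; j < n * m; real i \<le> real (n * m) * a; real (n * m) * a \<le> real i + 1;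
        real j \<le> real (n * m) * b; real (n * m) * b \<le> real j + 1\<rbrakk>
      \<Longrightarrow> h (a, b) (v i j) \<noteq> 0"
proof -
  let ?Q = "{0..1::real} \<times> {0..1::real}"
  let ?R = "geometric_realization X"
  have h': "continuous_map (top_of_set ?Q) ?R h" using h by (simp add: prod_topology_subtopology_eu)
  have "\<exists>W. open W \<and> {z \<in> ?Q. h z v \<noteq> 0} = ?Q \<inter> W" for v
  proof -
    have "openin (top_of_set ?Q) {z \<in> topspace (top_of_set ?Q). h z \<in> {t \<in> topspace ?R. t v \<noteq> 0}}"
      by (rule openin_continuous_map_preimage[OF h' openin_star])
    moreover have "{z \<in> topspace (top_of_set ?Q). h z \<in> {t \<in> topspace ?R. t v \<noteq> 0}} = {z \<in> ?Q. h z v \<noteq> 0}"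
      using h' by (auto simp: continuous_map_def)
    ultimately show ?thesis by (simp add: openin_open)
  qed
  then obtain W where W: "\<And>v. open (W v)" "\<And>v. {z \<in> ?Q. h z v \<noteq> 0} = ?Q \<inter> W v" by metis
  have cov: "?Q \<subseteq> \<Union>(range W)"
  proof
    fix z assume z: "z \<in> ?Q"
    then have "h z \<in> topspace ?R" using h' by (auto simp: continuous_map_def)
    then obtain v where "h z v \<noteq> 0" using support_nonempty by blast
    then show "z \<in> \<Union>(range W)" using W(2) z by blast
  qed
  have "compact ?Q" by (intro compact_Times compact_Icc)
  from Lebesgue_number_lemma[OF this _ cov] W(1)
  obtain \<delta> where \<delta>: "0 < \<delta>" "\<And>T. T \<subseteq> ?Q \<Longrightarrow> diameter T < \<delta> \<Longrightarrow> \<exists>B\<in>range W. T \<subseteq> B" by blast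
  obtain m :: nat where m: "2 / \<delta> < m" using reals_Archimedean2 by blast
  have "0 < 2 / \<delta>" using \<delta>(1) by simp
  then have "0 < m" using m by linarith
  \<comment> \<open>With \<open>n * m\<close> instead of \<open>m\<close> parts the grid refines the
    \<open>n\<close> segments of the path to be lifted, so that the corners of the path are grid
    points.\<close>
  define N where "N = n * m"
  have N: "0 < N" "m \<le> N" using n \<open>0 < m\<close> by (simp_all add: N_def)
  have small: "2 / N < \<delta>"
  proof -
    have "2 / \<delta> < N" using m N(2) by linarith
    then show ?thesis using \<delta>(1) N(1) by (simp add: field_simps)
  qed
  have unit: "0 \<le> c \<and> c \<le> 1" if "k < n * m" "real k \<le> real (n * m) * c" "real (n * m) * c \<le> real k + 1" for k :: nat and c :: real
  proof -
    have "Suc k \<le> N" using that(1) by (simp add: N_def)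
    then have "real k + 1 \<le> real N" by linarith
    then have "0 \<le> N * c" "N * c \<le> N * 1" using that(2,3) by (auto simp: N_def)
    then show ?thesis using N(1) by (simp add: zero_le_mult_iff)
  qed
  define T where "T = (\<lambda>i j. {real i / N..(real i + 1) / N} \<times> {real j / N..(real j + 1) / N})" for i j :: nat
  have "\<exists>v. T i j \<subseteq> W v" if "i < N" "j < N" for i j :: nat
  proof -
    have I: "{real k / N..(real k + 1) / N} \<subseteq> {0..1}" if "k < N" for k :: nat
      using unit[of k] that N(1) by (fastforce simp: N_def field_simps)
    then have "T i j \<subseteq> ?Q" using that unfolding T_def by blast
    moreover have "diameter (T i j) \<le> 2 / N"
    proof (rule diameter_le)
      show "T i j \<noteq> {} \<or> 0 \<le> 2 / real N" by simp
      fix x y assume xy: "x \<in> T i j" "y \<in> T i j"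
      have "\<bar>a - b\<bar> \<le> 1 / N" if "a \<in> {real k / N..(real k + 1) / N}" "b \<in> {real k / N..(real k + 1) / N}" for a b :: real and k :: nat
        using that by (auto simp: add_divide_distrib)
      then have "\<bar>fst x - fst y\<bar> \<le> 1 / N" "\<bar>snd x - snd y\<bar> \<le> 1 / N"
        using xy unfolding T_def by (auto simp del: atLeastAtMost_iff)
      moreover have "norm (x - y) \<le> norm (fst (x - y)) + norm (snd (x - y))"
        by (metis norm_Pair_le prod.collapse)
      ultimately show "norm (x - y) \<le> 2 / N" by (simp add: fst_diff snd_diff)
    qed
    ultimately have "\<exists>B\<in>range W. T i j \<subseteq> B" using \<delta>(2) small by (meson le_less_trans)
    then show ?thesis by blast
  qed
  then obtain v where v: "\<And>i j. i < N \<Longrightarrow> j < N \<Longrightarrow> T i j \<subseteq> W (v i j)" by metis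
  show ?thesis
  proof (rule that[OF \<open>0 < m\<close>])
    fix i j :: nat and a b :: real
    assume ij: "i < n * m" "j < n * m"
      and a: "real i \<le> real (n * m) * a" "real (n * m) * a \<le> real i + 1"
      and b: "real j \<le> real (n * m) * b" "real (n * m) * b \<le> real j + 1"
    have "(a, b) \<in> T i j" using a b N(1) unfolding T_def N_def by (auto simp: field_simps)
    moreover have "(a, b) \<in> ?Q"
      using unit[of i a] unit[of j b] ij a b by simp
    ultimately show "h (a, b) (v i j) \<noteq> 0" using v[of i j] ij W(2)[of "v i j"] unfolding N_def by blast
  qed
qed

section \<open>Coverings of simply connected complexes\<close>

text \<open>A covering recorded on vertices and edges only: \<open>B\<close> and \<open>A\<close>
  are the vertices and edges upstairs. \<open>lift_triangle\<close> is the only higher dimensional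
  datum, and lifting homotopies of paths requires no more.\<close>

locale simplicial_covering =
  fixes X :: "'v set set" and B :: "'e set" and A :: "'e \<Rightarrow> 'e \<Rightarrow> bool" and \<pi> :: "'e \<Rightarrow> 'v"
  assumes complex: "simplicial_complex X"
    and mem: "A e f \<Longrightarrow> e \<in> B"
    and sym: "A e f \<Longrightarrow> A f e"
    and proj: "A e f \<Longrightarrow> {\<pi> e, \<pi> f} \<in> X \<and> \<pi> e \<noteq> \<pi> f"
    and unique: "\<lbrakk>A e f; A e f'; \<pi> f = \<pi> f'\<rbrakk> \<Longrightarrow> f = f'"
    and lift: "\<lbrakk>e \<in> B; {\<pi> e, x} \<in> X; \<pi> e \<noteq> x\<rbrakk> \<Longrightarrow> \<exists>f. A e f \<and> \<pi> f = x"
    and lift_triangle: "\<lbrakk>A e f; A e f'; f \<noteq> f'; {\<pi> e, \<pi> f, \<pi> f'} \<in> X\<rbrakk> \<Longrightarrow> A f f'"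
begin

text \<open>The end of the lift, starting at \<open>e\<close>, of the edge from
  \<open>\<pi> e\<close> to \<open>x\<close>. A constant step is allowed since neighbouring grid
  labels may coincide; the value means something only if \<open>{\<pi> e, x}\<close> is a
  simplex.\<close>

definition transport :: "'v \<Rightarrow> 'e \<Rightarrow> 'e" where
  "transport x e = (if \<pi> e = x then e else (THE f. A e f \<and> \<pi> f = x))"

lemma transport_eqI:
  assumes "f = e \<or> A e f" "\<pi> f = x" shows "transport x e = f"
proof (cases "f = e")
  case False
  then have "A e f" using assms by blast
  moreover from this have "(THE f. A e f \<and> \<pi> f = x) = f" using unique assms by (intro the_equality) auto
  ultimately show ?thesis using proj[of e f] assms(2) by (simp add: transport_def)
qed (use assms in \<open>simp add: transport_def\<close>)

lemma transport_cases:
  assumes "e \<in> B" "{\<pi> e, x} \<in> X"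
  shows "transport x e = e \<and> \<pi> e = x \<or> A e (transport x e) \<and> \<pi> (transport x e) = x"
proof (cases "\<pi> e = x")
  case False
  then obtain f where f: "A e f" "\<pi> f = x" using lift assms by blast
  then have "transport x e = f" by (intro transport_eqI) simp_all
  then show ?thesis using f by simp
qed (simp add: transport_def)

lemma transport_mem:
  assumes "e \<in> B" "{\<pi> e, x} \<in> X"
  shows "transport x e \<in> B" "\<pi> (transport x e) = x"
  using transport_cases[OF assms] mem[OF sym] assms(1) by auto

text \<open>There is no monodromy around one simplex: \<open>lift_triangle\<close> joins the two
  lifted neighbours of \<open>e\<close>. The simplex may be degenerate, again because grid labels
  may coincide.\<close>

lemma transport_triangle:
  assumes e: "e \<in> B" and s: "{\<pi> e, x, y} \<in> X"
  shows "transport y (transport x e) = transport y e"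
proof -
  have face: "t \<in> X" if "t \<subseteq> {\<pi> e, x, y}" "t \<noteq> {}" for t
    by (rule simplex_face[OF complex s that])
  have ex: "{\<pi> e, x} \<in> X" "{\<pi> e, y} \<in> X" by (rule face; blast)+
  note cx = transport_cases[OF e ex(1)] and cy = transport_cases[OF e ex(2)]
  consider "transport x e = e" | "transport y e = e" "\<pi> e = y" "A e (transport x e)"
    | "A e (transport x e)" "A e (transport y e)" "\<pi> (transport x e) = x" "\<pi> (transport y e) = y"
    using cx cy by blast
  then show ?thesis
  proof cases
    case 1 then show ?thesis by simp
  next
    case 2
    then show ?thesis using transport_eqI[of e "transport x e" y] sym by simp
  next
    case 3
    show ?thesis
    proof (cases "transport x e = transport y e")
      case True
      then show ?thesis using 3 by (simp add: transport_def)
    next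
      case False
      then have "A (transport x e) (transport y e)" using lift_triangle[OF 3(1,2)] 3 s by simp
      then show ?thesis using 3(4) by (intro transport_eqI) simp_all
    qed
  qed
qed

text \<open>Monodromy argument. The grid labels are a simplicial approximation of a null homotopy.
  Each row of labels is lifted from \<open>e 0\<close>; adjacent rows end at the same vertex by
  \<open>transport_triangle\<close>, the last row is constant, and row 0 follows the given
  path.\<close>

lemma closed_path_lifts_closed:
  assumes sc: "simply_connected_space (geometric_realization X)"
    and path: "\<And>i. i < n \<Longrightarrow> A (e i) (e (Suc i))" and ends: "\<pi> (e n) = \<pi> (e 0)"
  shows "e n = e 0"
proof (cases "n = 0")
  case False
  then have n: "0 < n" by simp
  let ?R = "geometric_realization X"
  define x where "x = \<pi> (e 0)"
  define p where "p = edge_path n (\<lambda>i. \<pi> (e i))"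
  have edge: "{\<pi> (e k), \<pi> (e (Suc k))} \<in> X" if "k < n" for k
    using proj[OF path[OF that]] by simp
  have "pathin ?R p" unfolding p_def using pathin_edge_path[of n "\<lambda>i. \<pi> (e i)" X] n edge by blast
  moreover have node: "p s = vertex_point (\<pi> (e k))" if "k \<le> n" "real n * s = real k" for k :: nat and s :: real
    unfolding p_def by (rule edge_path_node[OF that(1) n that(2)])
  have p01: "p 0 = vertex_point x" "p 1 = vertex_point x"
    using node[of 0 0] node[of n 1] n ends by (simp_all add: x_def)
  ultimately have "homotopic_with (\<lambda>q. q 0 = vertex_point x \<and> q 1 = vertex_point x)
      (top_of_set {0..1}) ?R p (\<lambda>_. vertex_point x)"
    using sc unfolding simply_connected_space_def by blast
  then obtain h where h: "continuous_map (prod_topology (top_of_set {0..1::real}) (top_of_set {0..1::real})) ?R h"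
    "\<And>s. h (0, s) = p s" "\<And>s. h (1, s) = vertex_point x"
    "\<And>t. t \<in> {0..1} \<Longrightarrow> h (t, 0) = vertex_point x \<and> h (t, 1) = vertex_point x"
    unfolding homotopic_with_def by blast
  obtain m :: nat and v where m: "0 < m" and v: "\<And>i j a b. \<lbrakk>i < n * m; j < n * m; real i \<le> real (n * m) * a; real (n * m) * a \<le> real i + 1;
        real j \<le> real (n * m) * b; real (n * m) * b \<le> real j + 1\<rbrakk> \<Longrightarrow> h (a, b) (v i j) \<noteq> 0"
    using grid_labels[OF h(1) n] by blast
  define N where "N = n * m"
  have N: "0 < N" using n m by (simp add: N_def)
  \<comment> \<open>A grid point is a corner of up to four squares, and its image is in the open
    star of the label of each of them.\<close>
  have lab: "h (i / N, j / N) (v i' j') \<noteq> 0"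
    if "i' < N" "j' < N" "i' \<le> i" "i \<le> Suc i'" "j' \<le> j" "j \<le> Suc j'" for i j i' j'
    using v[of i' j' "i / N" "j / N"] that N by (auto simp: N_def)
  have top: "h (i / N, j / N) \<in> topspace ?R" if "i \<le> N" "j \<le> N" for i j
  proof -
    have "(i / N, j / N) \<in> {0..1} \<times> {0..1}" using that N by simp
    then show ?thesis using h(1) by (auto simp: continuous_map_def)
  qed
  have simplex: "S \<in> X" if "S \<subseteq> {u. h (i / N, j / N) u \<noteq> 0}" "S \<noteq> {}" "i \<le> N" "j \<le> N" for S i j
    using support_simplex[OF complex top[OF that(3,4)] that(1,2)] .
  have vx: "u = x" if "vertex_point x u \<noteq> 0" for u using that by (auto simp: vertex_point_def split: if_splits)
  \<comment> \<open>Three sides of the square are mapped to the vertex \<open>x\<close>, which lies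
    in no open star but its own, so the labels along them are forced.\<close>
  have left: "v i 0 = x" if "i < N" for i
    using lab[of i 0 i 0] that N h(4)[of "i / N"] by (intro vx) auto
  have right: "v i (N - 1) = x" if "i < N" for i
    using lab[of i "N - 1" i N] that N h(4)[of "i / N"] by (intro vx) auto
  have upper: "v (N - 1) j = x" if "j < N" for j
    using lab[of "N - 1" j N j] that N h(3)[of "j / N"] by (intro vx) auto
  define R where "R = (\<lambda>i. rec_nat (e 0) (\<lambda>j. transport (v i (Suc j))))"
  have R0: "R i 0 = e 0" and RS: "R i (Suc j) = transport (v i (Suc j)) (R i j)" for i j
    by (simp_all add: R_def)
  have e0: "e 0 \<in> B" using mem path n by blast
  have step: "{v i j, v i (Suc j)} \<in> X" if "i < N" "Suc j < N" for i j
    using that lab[of i j i "Suc j"] lab[of i "Suc j" i "Suc j"]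
    by (intro simplex[of _ i "Suc j"]) auto
  have R: "R i j \<in> B \<and> \<pi> (R i j) = v i j" if "i < N" "j < N" for i j
    using that(2)
  proof (induction j)
    case 0
    then show ?case using left[OF that(1)] e0 by (simp add: R0 x_def)
  next
    case (Suc j)
    then show ?case using transport_mem[of "R i j" "v i (Suc j)"] step[of i j] that by (simp add: RS)
  qed
  have rows: "R (Suc i) j = transport (v (Suc i) j) (R i j)" if "Suc i < N" "j < N" for i j
    using that(2)
  proof (induction j)
    case 0
    then show ?case using left[OF that(1)] by (simp add: R0 x_def transport_def)
  next
    case (Suc j)
    have r: "R i j \<in> B" "\<pi> (R i j) = v i j" using R[of i j] that Suc.prems by auto
    \<comment> \<open>The four squares around the corner \<open>(Suc i, Suc j)\<close> have labels
      in a common simplex. Both ways from \<open>v i j\<close> to \<open>v (Suc i) (Suc j)\<close>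
      transport like the diagonal.\<close>
    have "{v i j, v (Suc i) j, v (Suc i) (Suc j)} \<in> X" "{v i j, v i (Suc j), v (Suc i) (Suc j)} \<in> X"
      using that Suc.prems lab[of i j "Suc i" "Suc j"] lab[of "Suc i" j "Suc i" "Suc j"]
        lab[of i "Suc j" "Suc i" "Suc j"] lab[of "Suc i" "Suc j" "Suc i" "Suc j"]
      by (auto intro!: simplex[of _ "Suc i" "Suc j"])
    then show ?case
      using Suc transport_triangle[OF r(1), of "v (Suc i) j" "v (Suc i) (Suc j)"]
        transport_triangle[OF r(1), of "v i (Suc j)" "v (Suc i) (Suc j)"] r(2)
      by (simp add: RS)
  qed
  have last: "R i (N - 1) = R 0 (N - 1)" if "i < N" for i
    using that
  proof (induction i)
    case (Suc i)
    then show ?case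
      using rows[of i "N - 1"] R[of i "N - 1"] right[of i] right[of "Suc i"] by (simp add: transport_def)
  qed simp
  have "R (N - 1) j = e 0" if "j < N" for j
    using that
  proof (induction j)
    case (Suc j)
    then show ?case using upper[of "Suc j"] by (simp add: RS transport_def x_def)
  qed (simp add: R0)
  then have 1: "R 0 (N - 1) = e 0" using last[of "N - 1"] N by simp
  \<comment> \<open>Row 0 lies along the side on which the homotopy is the path itself; each edge of
    the path occupies \<open>m\<close> squares.\<close>
  have w: "v 0 j \<in> {\<pi> (e k), \<pi> (e (Suc k))}" if "k < n" "k * m \<le> j" "j < Suc k * m" for j k
  proof -
    have "Suc k * m \<le> n * m" using that(1) by (intro mult_le_mono1) simp
    then have j: "j < N" using that(3) by (simp add: N_def)
    have "p (j / N) (v 0 j) \<noteq> 0" using lab[of 0 j 0 j] j h(2) by simp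
    moreover have "real k \<le> n * (j / N)" "n * (j / N) \<le> real k + 1"
    proof -
      have eq: "n * (j / N) = real j / m" using n m by (simp add: N_def)
      have "real (k * m) \<le> j" "real j \<le> real (Suc k * m)" using that by (simp_all del: of_nat_mult)
      then show "real k \<le> n * (j / N)" "n * (j / N) \<le> real k + 1"
        unfolding eq using m by (simp_all add: field_simps)
    qed
    ultimately show ?thesis using edge_path_support[OF that(1), of "j / N" "\<lambda>i. \<pi> (e i)" "v 0 j"]
      unfolding p_def by simp
  qed
  \<comment> \<open>At a corner of the path the image is a vertex, which forces the labels of the
    squares on both sides.\<close>
  have node_label: "v 0 j = \<pi> (e k)" if "k \<le> n" "j < N" "k * m = j \<or> k * m = Suc j" for j k
  proof -
    have "p (k * m / N) (v 0 j) \<noteq> 0" using lab[of 0 j 0 "k * m"] that h(2) by auto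
    moreover have "n * (real (k * m) / N) = k" using n m by (simp add: N_def)
    ultimately have "vertex_point (\<pi> (e k)) (v 0 j) \<noteq> 0" using node[OF that(1)] by metis
    then show ?thesis by (auto simp: vertex_point_def split: if_splits)
  qed
  have bottom: "R 0 j \<in> {e (j div m), e (Suc (j div m))}" if "j < N" for j
    using that
  proof (induction j)
    case 0 then show ?case by (simp add: R0)
  next
    case (Suc j)
    define k where "k = j div m"
    have k: "k < n" "k * m \<le> j" "j < Suc k * m"
      using Suc.prems m div_times_less_eq_dividend[of j m] dividend_less_div_times[of m j]
        less_mult_imp_div_less[of j n m]
      unfolding k_def N_def by simp_all
    have IH: "R 0 j = e k \<or> R 0 j = e (Suc k)" using Suc by (simp add: k_def)
    have Ak: "A (e k) (e (Suc k))" by (rule path[OF k(1)])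
    show ?case
    proof (cases "Suc j = Suc k * m")
      \<comment> \<open>The next square belongs to the next edge of the path. The labels on both
        sides are the corner, so the lift has arrived at \<open>e (Suc k)\<close> before the edge
        changes.\<close>
      case True
      have "v 0 j = \<pi> (e (Suc k))" "v 0 (Suc j) = \<pi> (e (Suc k))"
        using node_label[of "Suc k"] k True Suc.prems by auto
      moreover from this have "R 0 j = e (Suc k)" using IH R[of 0 j] N Suc.prems proj[OF Ak] by auto
      ultimately have "R 0 (Suc j) = e (Suc k)" by (simp add: RS transport_def)
      moreover have "Suc j div m = Suc k" using True m by simp
      ultimately show ?thesis by simp
    next
      case False
      then have jm: "Suc j < Suc k * m" using k(3) by simp
      then have "Suc j div m = k" using k(2) m by (intro div_nat_eqI) (auto simp: mult.commute)
      moreover have "v 0 (Suc j) \<in> {\<pi> (e k), \<pi> (e (Suc k))}" using w[OF k(1) _ jm] k(2) by simp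
      then have "transport (v 0 (Suc j)) (R 0 j) \<in> {e k, e (Suc k)}"
        using IH transport_eqI[of "e k" "e k" "v 0 (Suc j)"] transport_eqI[of "e (Suc k)" "e k" "v 0 (Suc j)"]
          transport_eqI[of "e k" "e (Suc k)" "v 0 (Suc j)"]
          transport_eqI[of "e (Suc k)" "e (Suc k)" "v 0 (Suc j)"] Ak sym[OF Ak] by auto
      ultimately show ?thesis by (simp add: RS)
    qed
  qed
  have k: "(N - 1) div m = n - 1"
    using n m by (intro div_nat_eqI) (auto simp: N_def algebra_simps diff_mult_distrib2)
  \<comment> \<open>The last label is \<open>x\<close>, the projection of \<open>e n\<close>, and
    this rules out \<open>e (n - 1)\<close>.\<close>
  have "R 0 (N - 1) \<in> {e (n - 1), e n}" using bottom[of "N - 1"] N n unfolding k by simp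
  moreover have "\<pi> (R 0 (N - 1)) = \<pi> (e n)" using R[of 0 "N - 1"] right[of 0] N ends by (simp add: x_def)
  moreover have "\<pi> (e (n - 1)) \<noteq> \<pi> (e n)" using proj[OF path[of "n - 1"]] n by simp
  ultimately have "R 0 (N - 1) = e n" by auto
  then show ?thesis using 1 by simp
qed simp

end

section \<open>Cycles and links\<close>

text \<open>Lets a polygon be treated as the image of a simple closed path in a function
  space.\<close>

lemma geometric_realization_finite:
  assumes "finite C" "\<And>s. s \<in> C \<Longrightarrow> finite s"
  shows "geometric_realization C = top_of_set (\<Union>s\<in>C. geometric_simplex s)"
  unfolding topology_eq
proof (intro allI iffI)
  let ?S = "\<Union>s\<in>C. geometric_simplex s"
  fix U assume U: "openin (geometric_realization C) U"
  have "continuous_map (top_of_set ?S) (geometric_realization C) (\<lambda>x. x)"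
    by (rule continuous_into_realization[OF assms(1) order_refl assms(2)]) (auto simp: continuous_map_from_subtopology)
  then have "openin (top_of_set ?S) {x \<in> ?S. x \<in> U}"
    using U by (auto simp: continuous_map_def)
  moreover have "U \<subseteq> ?S" using U by (simp add: openin_geometric_realization)
  then have "{x \<in> ?S. x \<in> U} = U" by blast
  ultimately show "openin (top_of_set ?S) U" by (metis (no_types, lifting))
next
  let ?S = "\<Union>s\<in>C. geometric_simplex s"
  fix U assume "openin (top_of_set ?S) U"
  then obtain V where "open V" "U = ?S \<inter> V" by (auto simp: openin_open)
  moreover from this have "U \<inter> geometric_simplex s = geometric_simplex s \<inter> V" if "s \<in> C" for s
    using that by blast
  ultimately show "openin (geometric_realization C) U"
    unfolding openin_geometric_realization by (auto simp: openin_open)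
qed

lemma open_coordinate_vimage: "open W \<Longrightarrow> open ((\<lambda>h. h i) -` W)"
  by (rule open_vimage[OF _ continuous_on_product_coordinates])

text \<open>The library has these arities only for countable index types; the one for \<open>t2_space\<close> is
  accepted only after those of its superclasses.\<close>
instance "fun" :: (type, t0_space) t0_space
proof
  fix f g :: "'a \<Rightarrow> 'b"
  assume "f \<noteq> g"
  then obtain i where i: "f i \<noteq> g i" by (auto simp: fun_eq_iff)
  then obtain U where "open U" "(f i \<in> U) \<noteq> (g i \<in> U)" using separation_t0[of "f i" "g i"] i by metis
  then show "\<exists>U. open U \<and> \<not> (f \<in> U \<longleftrightarrow> g \<in> U)"
    by (intro exI[of _ "(\<lambda>h. h i) -` U"]) (simp add: open_coordinate_vimage)
qed

instance "fun" :: (type, t1_space) t1_space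
proof
  fix f g :: "'a \<Rightarrow> 'b"
  assume "f \<noteq> g"
  then obtain i where i: "f i \<noteq> g i" by (auto simp: fun_eq_iff)
  then obtain U where "open U" "f i \<in> U" "g i \<notin> U" using separation_t1[of "f i" "g i"] i by metis
  then show "\<exists>U. open U \<and> f \<in> U \<and> g \<notin> U"
    by (intro exI[of _ "(\<lambda>h. h i) -` U"]) (simp add: open_coordinate_vimage)
qed

instance "fun" :: (type, t2_space) t2_space
proof
  fix f g :: "'a \<Rightarrow> 'b"
  assume "f \<noteq> g"
  then obtain i where i: "f i \<noteq> g i" by (auto simp: fun_eq_iff)
  then obtain U V where UV: "open U" "open V" "f i \<in> U" "g i \<in> V" "U \<inter> V = {}"
    using hausdorff[OF i] by metis
  then show "\<exists>U V. open U \<and> open V \<and> f \<in> U \<and> g \<in> V \<and> U \<inter> V = {}"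
    using open_coordinate_vimage[OF UV(1), of i] open_coordinate_vimage[OF UV(2), of i]
    by (intro exI[of _ "(\<lambda>h. h i) -` U"] exI[of _ "(\<lambda>h. h i) -` V"]) auto
qed

lemma homeomorphic_imp_homeomorphic_space:
  assumes "S homeomorphic T" shows "top_of_set S homeomorphic_space top_of_set T"
proof -
  obtain f g where "homeomorphism S T f g" using assms by (auto simp: homeomorphic_def)
  then have "homeomorphic_maps (top_of_set S) (top_of_set T) f g"
    by (auto simp: homeomorphic_maps_def homeomorphism_def)
  then show ?thesis by (auto simp: homeomorphic_space_def)
qed

definition cycle_complex :: "nat \<Rightarrow> (nat \<Rightarrow> 'v) \<Rightarrow> 'v set set" where
  "cycle_complex n w = (\<lambda>k. {w k}) ` {..<n} \<union> (\<lambda>k. {w k, w (Suc k)}) ` {..<n}"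

text \<open>The nonzero coordinates of a point determine its segment, as a polygon with at least
  three vertices has no two edges with the same ends; on a segment the coordinates determine the
  time.\<close>

lemma edge_path_inj:
  assumes n: "3 \<le> n" and inj: "inj_on w {..<n}" and loop: "w n = w 0"
    and s: "0 \<le> s" "s < 1" and t: "0 \<le> t" "t < 1" and eq: "edge_path n w s = edge_path n w t"
  shows "s = t"
proof -
  have ex: "\<exists>k<n. real k \<le> n * s \<and> n * s < real k + 1" if "0 \<le> s" "s < 1" for s :: real
  proof (intro exI conjI)
    have "n * s < n" using that n by simp
    then show "nat \<lfloor>n * s\<rfloor> < n" using that by (simp add: nat_less_iff floor_less_iff)
    have "real (nat \<lfloor>n * s\<rfloor>) = of_int \<lfloor>n * s\<rfloor>" using that by simp
    then show "real (nat \<lfloor>n * s\<rfloor>) \<le> n * s" "n * s < real (nat \<lfloor>n * s\<rfloor>) + 1" by linarith+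
  qed
  obtain k where k: "k < n" "real k \<le> n * s" "n * s < real k + 1" using ex[OF s] by blast
  obtain l where l: "l < n" "real l \<le> n * t" "n * t < real l + 1" using ex[OF t] by blast
  have ne: "w i \<noteq> w (Suc i)" if "i < n" for i
  proof (cases "Suc i = n")
    case True then show ?thesis using inj_onD[OF inj, of i 0] loop n that by auto
  next
    case False then show ?thesis using inj_onD[OF inj, of i "Suc i"] that by auto
  qed
  have es: "edge_path n w s = (\<lambda>u. (1 - (n * s - k)) * vertex_point (w k) u + (n * s - k) * vertex_point (w (Suc k)) u)"
    using edge_path_segment[of k n s w] k by simp
  have et: "edge_path n w t = (\<lambda>u. (1 - (n * t - l)) * vertex_point (w l) u + (n * t - l) * vertex_point (w (Suc l)) u)"
    using edge_path_segment[of l n t w] l by simp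
  \<comment> \<open>Segments are taken half-open, so the coordinate at the initial vertex never
    vanishes.\<close>
  have vs: "edge_path n w s (w k) \<noteq> 0" and vt: "edge_path n w t (w l) \<noteq> 0"
    unfolding es et using k l ne[OF k(1)] ne[OF l(1)] by (auto simp: vertex_point_def)
  have "w k = w l \<or> w k = w (Suc l)" "w l = w k \<or> w l = w (Suc k)"
    using edge_path_support[of l n t w "w k"] edge_path_support[of k n s w "w l"] vs vt k l
    unfolding eq by auto
  \<comment> \<open>This would be one edge run through in both directions: \<open>k\<close> and
    \<open>l\<close> would follow each other cyclically, which forces
    \<open>n \<le> 2\<close>.\<close>
  moreover have "\<not> (w k = w (Suc l) \<and> w l = w (Suc k))"
  proof
    have suc: "i = Suc j \<or> i = 0 \<and> Suc j = n" if "w i = w (Suc j)" "i < n" "j < n" for i j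
    proof (cases "Suc j = n")
      case True
      then have "w i = w 0" using that loop by simp
      then show ?thesis using inj that(2) n True by (auto simp: inj_on_def)
    next
      case False
      then show ?thesis using inj that by (auto simp: inj_on_def)
    qed
    assume "w k = w (Suc l) \<and> w l = w (Suc k)"
    then show False using suc[of k l] suc[of l k] k(1) l(1) n by auto
  qed
  ultimately have "w k = w l" by metis
  then have "k = l" using inj k(1) l(1) by (auto simp: inj_on_def)
  moreover have "n * s - k = n * t - k"
    using fun_cong[OF eq, of "w k"] ne[OF k(1)] \<open>k = l\<close> unfolding es et by (simp add: vertex_point_def)
  ultimately show ?thesis using n by simp
qed

lemma cycle_complex_circle:
  assumes n: "3 \<le> n" and inj: "inj_on w {..<n}" and loop: "w n = w 0"
  shows "geometric_realization (cycle_complex n w) homeomorphic_space top_of_set (sphere (0::complex) 1)"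
proof -
  let ?C = "cycle_complex n w" and ?g = "edge_path n w"
  have n0: "0 < n" using n by simp
  have node: "?g s = vertex_point (w k)" if "k \<le> n" "real n * s = real k" for k s
    using edge_path_node[of k n s w] that n0 by blast
  have g1: "?g 1 = ?g 0" using node[of n 1] node[of 0 0] loop by simp
  have inj': "x = y" if "0 \<le> x" "x < 1" "0 \<le> y" "y < 1" "?g x = ?g y" for x y
    using edge_path_inj[OF n inj loop] that by blast
  have "simple_path ?g"
    unfolding simple_path_def loop_free_def
  proof (intro conjI ballI impI)
    show "path ?g" unfolding path_def by (rule continuous_edge_path)
    fix x y :: real assume xy: "x \<in> {0..1}" "y \<in> {0..1}" "?g x = ?g y"
    then consider "x < 1" "y < 1" | "x = 1" "y < 1" | "x < 1" "y = 1" | "x = 1" "y = 1" by fastforce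
    then show "x = y \<or> x = 0 \<and> y = 1 \<or> x = 1 \<and> y = 0"
    proof cases
      case 1 then show ?thesis using inj'[of x y] xy by simp
    next
      case 2 then show ?thesis using inj'[of 0 y] xy g1 by simp
    next
      case 3 then show ?thesis using inj'[of x 0] xy g1 by simp
    qed simp
  qed
  moreover have "pathfinish ?g = pathstart ?g" using g1 by (simp add: pathfinish_def pathstart_def)
  ultimately have "path_image ?g homeomorphic sphere (0::complex) 1"
    by (intro homeomorphic_simple_path_image_circle) simp_all
  moreover have "path_image ?g = (\<Union>s\<in>?C. geometric_simplex s)"
  proof
    show "path_image ?g \<subseteq> (\<Union>s\<in>?C. geometric_simplex s)"
    proof
      fix t assume "t \<in> path_image ?g"
      then obtain s where s: "0 \<le> s" "s \<le> 1" "t = ?g s" by (auto simp: path_image_def)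
      obtain k where "k < n" "real k \<le> n * s" "n * s \<le> real k + 1"
        using segment_exists[OF s(1,2) n0] by blast
      then show "t \<in> (\<Union>s\<in>?C. geometric_simplex s)"
        using edge_path_in_simplex[of k n s w] s(3) by (auto simp: cycle_complex_def)
    qed
    have edge: "t \<in> path_image ?g" if k: "k < n" and t: "t \<in> geometric_simplex {w k, w (Suc k)}" "w k \<noteq> w (Suc k)" for t k
    proof -
      define a where "a = t (w (Suc k))"
      have ta: "t (w k) = 1 - a" "0 \<le> a" "a \<le> 1" "\<And>u. u \<noteq> w k \<Longrightarrow> u \<noteq> w (Suc k) \<Longrightarrow> t u = 0"
        using t by (auto simp: geometric_simplex_def a_def) (smt (verit))
      define s where "s = (k + a) / n"
      have ns: "n * s = k + a" using n0 by (simp add: s_def)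
      have "s \<in> {0..1}"
      proof -
        have "real k + a \<le> n" using k ta(3) by linarith
        then show ?thesis using ta(2) n0 by (simp add: s_def)
      qed
      moreover have "?g s = t"
        using edge_path_segment[of k n s w] k ta t(2) ns by (auto simp: vertex_point_def a_def fun_eq_iff)
      ultimately show ?thesis by (auto simp: path_image_def)
    qed
    have vert: "t \<in> path_image ?g" if k: "k \<le> n" and t: "t \<in> geometric_simplex {w k}" for t k
    proof -
      have "t = vertex_point (w k)" using t by (auto simp: geometric_simplex_def vertex_point_def fun_eq_iff)
      then have "?g (k / n) = t" using node[of k "k / n"] k n0 by simp
      moreover have "k / n \<in> {0..1}" using k n0 by simp
      ultimately show ?thesis by (metis image_eqI path_image_def)
    qed
    show "(\<Union>s\<in>?C. geometric_simplex s) \<subseteq> path_image ?g"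
    proof
      fix t assume "t \<in> (\<Union>s\<in>?C. geometric_simplex s)"
      then obtain k where k: "k < n" and "t \<in> geometric_simplex {w k} \<or> t \<in> geometric_simplex {w k, w (Suc k)}"
        by (auto simp: cycle_complex_def)
      then show "t \<in> path_image ?g"
        using vert[of k t] edge[of k t] by (cases "w k = w (Suc k)") auto
    qed
  qed
  moreover have "geometric_realization ?C = top_of_set (\<Union>s\<in>?C. geometric_simplex s)"
    by (rule geometric_realization_finite) (auto simp: cycle_complex_def)
  ultimately show ?thesis using homeomorphic_imp_homeomorphic_space by metis
qed

lemma cycle_complex_cycle:
  assumes "3 \<le> n" "inj_on w {..<n}" "w n = w 0" "cycle_complex n w \<subseteq> X"
  shows "cycle_in X (cycle_complex n w)"
  unfolding cycle_in_def
proof (intro conjI assms(4) cycle_complex_circle[OF assms(1-3)])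
  have "w ` {..<n} = w ` {..n}"
  proof -
    have "w ` {..n} = insert (w n) (w ` {..<n})" by (simp add: lessThan_Suc_atMost[symmetric] lessThan_Suc)
    also have "\<dots> = w ` {..<n}" using assms(1,3) by (intro insert_absorb) auto
    finally show ?thesis by simp
  qed
  then have vert: "{w k} \<in> cycle_complex n w" if "k \<le> n" for k
    using that unfolding cycle_complex_def by fastforce
  show "simplicial_complex (cycle_complex n w)"
    unfolding simplicial_complex_def
  proof (intro conjI ballI allI impI)
    fix s t assume s: "s \<in> cycle_complex n w" and t: "t \<subseteq> s \<and> t \<noteq> {}"
    show "t \<in> cycle_complex n w"
    proof (cases "t = s")
      case False
      obtain k where k: "k < n" "s = {w k} \<or> s = {w k, w (Suc k)}" using s by (auto simp: cycle_complex_def)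
      then have "t \<in> Pow {w k, w (Suc k)}" using t by auto
      then have "t = {w k} \<or> t = {w (Suc k)}" using t False k(2) by (auto simp: Pow_insert)
      then show ?thesis using vert[of k] vert[of "Suc k"] k(1) by auto
    qed (use s in simp)
  qed (auto simp: cycle_complex_def)
qed

definition edge_rel :: "'v set set \<Rightarrow> 'v \<Rightarrow> 'v \<Rightarrow> bool" where
  "edge_rel X x y \<longleftrightarrow> {x, y} \<in> X \<and> x \<noteq> y"

text \<open>Also the edge relation of the link of \<open>x\<close> (\<open>link_edge\<close>). Its
  symmetry in all three vertices is what allows arguments to pass from one link to another.\<close>

definition triangle_rel :: "'v set set \<Rightarrow> 'v \<Rightarrow> 'v \<Rightarrow> 'v \<Rightarrow> bool" where
  "triangle_rel X x y z \<longleftrightarrow> {x, y, z} \<in> X \<and> x \<noteq> y \<and> y \<noteq> z \<and> x \<noteq> z"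

lemma link_edge:
  assumes "simplicial_complex X"
  shows "{a, b} \<in> edges (link X v) \<longleftrightarrow> triangle_rel X v a b"
proof -
  have "{a, b} \<in> X" if "{v, a, b} \<in> X"
    by (rule simplex_face[OF assms that]) auto
  then show ?thesis by (auto simp: edges_def link_def triangle_rel_def card_insert_if)
qed

lemma link_vertex:
  assumes "simplicial_complex X" "triangle_rel X v a b"
  shows "{a} \<in> link X v"
proof -
  have "{v, a, b} \<in> X" using assms(2) by (simp add: triangle_rel_def)
  then have "{a} \<in> X" "{v, a} \<in> X" by (auto intro: simplex_face[OF assms(1)])
  then show ?thesis using assms(2) by (auto simp: link_def triangle_rel_def)
qed

text \<open>Largeness speaks of subcomplexes homeomorphic to a circle; this is its form for closed
  vertex sequences. The number of edges is a premise, checked by enumeration for lengths 4 and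
  5.\<close>

lemma link_cycle_diagonal:
  assumes X: "simplicial_complex X" and large: "k_large k (link X v)"
    and n: "4 \<le> n" "n < k" and inj: "inj_on w {..<n}" and loop: "w n = w 0"
    and tri: "\<And>i. i < n \<Longrightarrow> triangle_rel X v (w i) (w (Suc i))"
    and len: "card (edges (cycle_complex n w)) = n"
  obtains i j where "i < n" "j < n" "triangle_rel X v (w i) (w j)" "{w i, w j} \<notin> edges (cycle_complex n w)"
proof -
  let ?C = "cycle_complex n w"
  have "?C \<subseteq> link X v"
    using link_vertex[OF X tri] tri link_edge[OF X] by (fastforce simp: cycle_complex_def edges_def)
  then have "cycle_in (link X v) ?C" using cycle_complex_cycle[OF _ inj loop] n by simp
  then obtain e where e: "is_diagonal (link X v) ?C e"
    using large n len unfolding k_large_def cycle_length_def by auto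
  then have e': "e \<in> edges (link X v)" "e \<subseteq> \<Union>?C" "e \<notin> edges ?C" by (auto simp: is_diagonal_def)
  have "\<Union>?C \<subseteq> w ` {..<n}"
  proof -
    have "w (Suc k) \<in> w ` {..<n}" if "k < n" for k
      using that loop n by (cases "Suc k = n") auto
    then show ?thesis by (auto simp: cycle_complex_def)
  qed
  moreover obtain a b where "e = {a, b}" using e'(1) by (auto simp: edges_def card_2_iff)
  ultimately obtain i j where "i < n" "j < n" "e = {w i, w j}" using e'(2) by blast
  then show ?thesis using that e' link_edge[OF X] by blast
qed

section \<open>The universal cover of a locally 6-large complex\<close>

text \<open>Local 6-largeness as far as it is used: \<open>tri v a b\<close> reads as an edge from
  \<open>a\<close> to \<open>b\<close> in the link of \<open>v\<close>, and the last three
  assumptions treat 3-, 4- and 5-cycles there. Flagness is kept only through its consequence for the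
  face opposite to \<open>v\<close>.\<close>

locale locally_six_large =
  fixes adj :: "'v \<Rightarrow> 'v \<Rightarrow> bool" and tri :: "'v \<Rightarrow> 'v \<Rightarrow> 'v \<Rightarrow> bool"
  assumes adj_sym: "adj x y \<Longrightarrow> adj y x"
    and adj_irrefl: "\<not> adj x x"
    and tri_rotate: "tri x y z \<Longrightarrow> tri y z x"
    and tri_swap: "tri x y z \<Longrightarrow> tri y x z"
    and tri_adj: "tri x y z \<Longrightarrow> adj x y"
    and link_flag: "\<lbrakk>tri v a b; tri v b c; tri v a c\<rbrakk> \<Longrightarrow> tri a b c"
    and link_square: "\<lbrakk>tri v a b; tri v b c; tri v c d; tri v d a; a \<noteq> c; b \<noteq> d\<rbrakk>
      \<Longrightarrow> tri v a c \<or> tri v b d"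
    and link_pentagon: "\<lbrakk>tri v a b; tri v b c; tri v c d; tri v d e; tri v e a; distinct [a, b, c, d, e]\<rbrakk>
      \<Longrightarrow> tri v a c \<or> tri v b d \<or> tri v c e \<or> tri v d a \<or> tri v e b"
begin

lemma tri_perms:
  assumes "tri x y z"
  shows "tri x z y" "tri y x z" "tri y z x" "tri z x y" "tri z y x"
  using assms tri_rotate tri_swap by blast+

lemma tri_distinct: "tri x y z \<Longrightarrow> x \<noteq> y \<and> y \<noteq> z \<and> x \<noteq> z"
  using tri_adj adj_irrefl tri_perms by metis

end

text \<open>A vertex \<open>e\<close> of the cover is a list of vertices of the complex: \<open>hd e\<close> is its projection,
  \<open>length e - 1\<close> its distance from the root \<open>[r]\<close>.\<close>
locale graded_cover = locally_six_large adj tri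
  for adj :: "'v \<Rightarrow> 'v \<Rightarrow> bool" and tri +
  fixes r :: 'v and B :: "'v list set" and A :: "'v list \<Rightarrow> 'v list \<Rightarrow> bool"
  assumes root_mem: "[r] \<in> B"
    and level_pos: "e \<in> B \<Longrightarrow> 1 \<le> length e"
    and level_one: "e \<in> B \<Longrightarrow> length e = 1 \<Longrightarrow> e = [r]"
    and A_mem: "A e f \<Longrightarrow> e \<in> B"
    and A_sym: "A e f \<Longrightarrow> A f e"
    and A_adj: "A e f \<Longrightarrow> adj (hd e) (hd f)"
    and A_level: "A e f \<Longrightarrow> length f \<le> Suc (length e)"
    and lift_unique: "\<lbrakk>A e f; A e f'; hd f = hd f'\<rbrakk> \<Longrightarrow> f = f'"
    and lift_tri: "\<lbrakk>A e f; A e f'\<rbrakk> \<Longrightarrow> A f f' \<longleftrightarrow> tri (hd e) (hd f) (hd f')"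
    and parents_clique: "\<lbrakk>A e p; A e q; length e = Suc (length p); length e = Suc (length q)\<rbrakk>
      \<Longrightarrow> p = q \<or> A p q"
    and common_parent: "\<lbrakk>A e f; length e = length f\<rbrakk>
      \<Longrightarrow> \<exists>p. A e p \<and> A f p \<and> length e = Suc (length p)"
    and parent_exists: "\<lbrakk>e \<in> B; 1 < length e\<rbrakk> \<Longrightarrow> \<exists>p. A e p \<and> length e = Suc (length p)"
begin

lemma A_mem2: "A e f \<Longrightarrow> f \<in> B" using A_mem A_sym by blast

lemma A_irrefl: "\<not> A e e" using A_adj adj_irrefl by blast

end

text \<open>The ball of levels 1 to \<open>n\<close>. Only vertices on the boundary level
  \<open>n\<close> may still lack neighbours.\<close>

locale partial_cover = graded_cover adj tri r B A
  for adj :: "'v \<Rightarrow> 'v \<Rightarrow> bool" and tri r B A +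
  fixes n :: nat
  assumes level_le: "e \<in> B \<Longrightarrow> length e \<le> n"
    and lift_exists: "\<lbrakk>e \<in> B; length e < n; adj (hd e) x\<rbrakk> \<Longrightarrow> \<exists>f. A e f \<and> hd f = x"
begin

text \<open>Two new edges at the boundary vertices \<open>w\<close> and \<open>w'\<close> lead to the same new vertex over \<open>x\<close> iff
  they span a triangle; the new vertex is \<open>x\<close> followed by a chosen member of its class.\<close>
definition fresh :: "'v list \<Rightarrow> 'v \<Rightarrow> bool" where
  "fresh w x \<longleftrightarrow> w \<in> B \<and> length w = n \<and> adj (hd w) x \<and> (\<forall>f. A w f \<longrightarrow> hd f \<noteq> x)"

definition same_child :: "'v \<Rightarrow> 'v list \<Rightarrow> 'v list \<Rightarrow> bool" where
  "same_child x w w' \<longleftrightarrow> fresh w x \<and> fresh w' x \<and> (w = w' \<or> A w w' \<and> tri (hd w) (hd w') x)"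

definition child :: "'v list \<Rightarrow> 'v \<Rightarrow> 'v list" where
  "child w x = x # (SOME w'. same_child x w w')"

definition parent :: "'v list \<Rightarrow> 'v list \<Rightarrow> bool" where
  "parent e w \<longleftrightarrow> fresh w (hd e) \<and> e = child w (hd e)"

definition B' :: "'v list set" where
  "B' = B \<union> {e. \<exists>w. parent e w}"

text \<open>Two new vertices are joined only through a shared parent. This builds the projection
  property of edges into the construction; the price is that triangles among new vertices need a
  proof (\<open>A'_lift_tri\<close>).\<close>

definition A' :: "'v list \<Rightarrow> 'v list \<Rightarrow> bool" where
  "A' e f \<longleftrightarrow> A e f \<or> parent e f \<or> parent f e \<or>
     (\<exists>w. parent e w \<and> parent f w \<and> tri (hd w) (hd e) (hd f))"

text \<open>All neighbours of the interior vertex \<open>p\<close> are lifted already, so such a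
  triangle would give a lift of \<open>x\<close> adjacent to \<open>p\<close> and, by
  \<open>lift_tri\<close>, to \<open>w\<close>.\<close>

lemma fresh_no_tri_parent:
  assumes "fresh w x" "A w p" "length p < n"
  shows "\<not> tri (hd w) (hd p) x"
proof
  assume t: "tri (hd w) (hd p) x"
  then have "adj (hd p) x" using tri_adj tri_perms by blast
  then obtain f where f: "A p f" "hd f = x"
    using lift_exists[of p x] assms A_mem2 by blast
  have "A w f" using lift_tri[of p w f] f assms t A_sym tri_perms by blast
  then show False using f assms(1) by (auto simp: fresh_def)
qed

lemma fresh_transfer:
  assumes "fresh w x" "A w w'" "length w' = n" "tri (hd w) (hd w') x"
  shows "fresh w' x"
proof -
  have "\<not> A w' f" if "hd f = x" for f
  proof
    assume "A w' f"
    then have "A w f" using lift_tri[of w' w f] A_sym assms that tri_perms by blast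
    then show False using assms(1) that by (auto simp: fresh_def)
  qed
  moreover have "adj (hd w') x" using assms(4) tri_adj tri_perms by blast
  ultimately show ?thesis using assms A_mem2 by (auto simp: fresh_def)
qed

lemma same_child_sym: "same_child x w w' \<Longrightarrow> same_child x w' w"
  unfolding same_child_def using A_sym tri_perms by blast

text \<open>With common parents \<open>p\<close> and \<open>q\<close>, the vertices
  \<open>x\<close>, \<open>hd w1\<close>, \<open>hd p\<close>, \<open>hd q\<close>,
  \<open>hd w3\<close> form a closed walk in the link of \<open>hd w2\<close>. As \<open>x\<close>
  is joined to neither parent, a diagonal of the pentagon avoids \<open>x\<close>; each such
  diagonal either is the wanted edge or leaves a 4-cycle through \<open>x\<close> that yields it.
  Coincidences only shorten the walk.\<close>

lemma same_child_trans_aux: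
  assumes f: "fresh w1 x" "fresh w2 x" "fresh w3 x"
    and 1: "A w1 w2" "tri (hd w1) (hd w2) x" and 2: "A w2 w3" "tri (hd w2) (hd w3) x"
    and ne: "w1 \<noteq> w3"
  shows "A w1 w3 \<and> tri (hd w1) (hd w3) x"
proof -
  have len: "length w1 = n" "length w2 = n" "length w3 = n" using f by (auto simp: fresh_def)
  obtain p where p: "A w1 p" "A w2 p" "length w1 = Suc (length p)"
    using common_parent[OF 1(1)] len by auto
  obtain q where q: "A w2 q" "A w3 q" "length w2 = Suc (length q)"
    using common_parent[OF 2(1)] len by auto
  let ?v = "hd w2" and ?a = "hd w1" and ?c = "hd w3" and ?p = "hd p" and ?q = "hd q"
  have xp: "\<not> tri ?v ?p x" "\<not> tri ?v ?q x"
    using fresh_no_tri_parent f(2) p q len by auto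
  have t1: "tri ?v ?a ?p" using lift_tri[of w2 w1 p] p 1 A_sym by blast
  have t2: "tri ?v ?c ?q" using lift_tri[of w2 w3 q] q 2 A_sym by blast
  have ac: "?a \<noteq> ?c" using lift_unique[of w2 w1 w3] 1 2 A_sym ne by blast
  have tx: "tri ?v x ?a" "tri ?v ?c x" using 1 2 tri_perms by blast+
  have px: "?p \<noteq> x" "?q \<noteq> x" using f(2) p q by (auto simp: fresh_def)
  have key: "tri ?v ?a ?c"
  proof (cases "p = q")
    case True
    then show ?thesis
      using link_square[of ?v x ?a ?p ?c] t1 t2 tx tri_perms xp px ac by blast
  next
    case False
    then have "A p q" using parents_clique[of w2 p q] p q len by auto
    then have pq: "tri ?v ?p ?q" using lift_tri[of w2 p q] p q by blast
    have dist: "?p \<noteq> ?q" "?a \<noteq> ?p" "?c \<noteq> ?q" using pq t1 t2 tri_distinct by blast+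
    consider "?a = ?q" | "?c = ?p" | "?a \<noteq> ?q" "?c \<noteq> ?p" by blast
    then show ?thesis
    proof cases
      case 1 then show ?thesis using t2 tri_perms by metis
    next
      case 2 then show ?thesis using t1 by metis
    next
      case 3
      have "distinct [x, ?a, ?p, ?q, ?c]"
        using dist 3 ac px tx tri_distinct by auto
      then have "tri ?v ?a ?c \<or> tri ?v ?a ?q \<or> tri ?v ?p ?c"
        using link_pentagon[of ?v x ?a ?p ?q ?c] tx t1 t2 pq xp tri_perms by blast
      moreover have "tri ?v ?a ?c" if "tri ?v ?a ?q"
        using link_square[of ?v x ?a ?q ?c] that tx t2 tri_perms xp px ac by blast
      moreover have "tri ?v ?a ?c" if "tri ?v ?p ?c"
        using link_square[of ?v x ?a ?p ?c] that tx t1 tri_perms xp px ac by blast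
      ultimately show ?thesis by blast
    qed
  qed
  then have "A w1 w3" using lift_tri[of w2 w1 w3] 1 2 A_sym by blast
  moreover have "tri ?a ?c x" using link_flag[of ?v ?a ?c x] key tx tri_perms by blast
  ultimately show ?thesis by blast
qed

lemma same_child_trans:
  assumes "same_child x w1 w2" "same_child x w2 w3"
  shows "same_child x w1 w3"
  using assms same_child_trans_aux[of w1 x w2 w3] unfolding same_child_def by blast

text \<open>As \<open>same_child x\<close> is symmetric and transitive, equivalent boundary vertices
  define the same predicate, so \<open>SOME\<close> picks the same representative for both.\<close>

lemma child_eq_iff:
  assumes "fresh w x" "fresh w' x"
  shows "child w x = child w' x \<longleftrightarrow> same_child x w w'"
proof
  assume eq: "child w x = child w' x"
  have s: "same_child x v (SOME w'. same_child x v w')" if "fresh v x" for v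
    by (rule someI[of _ v]) (use that in \<open>auto simp: same_child_def\<close>)
  show "same_child x w w'"
    using s[OF assms(1)] s[OF assms(2)] eq same_child_sym same_child_trans
    by (metis child_def list.inject)
next
  assume "same_child x w w'"
  then have "same_child x w = same_child x w'"
    using same_child_sym same_child_trans by blast
  then show "child w x = child w' x" by (simp add: child_def)
qed

lemma hd_child [simp]: "hd (child w x) = x" by (simp add: child_def)

lemma length_child:
  assumes "fresh w x"
  shows "length (child w x) = Suc n"
proof -
  have "same_child x w w" using assms by (simp add: same_child_def)
  then have "same_child x w (Eps (same_child x w))" by (rule someI)
  then have "fresh (Eps (same_child x w)) x" unfolding same_child_def[of x w "Eps _"] by blast
  then show ?thesis unfolding child_def fresh_def by simp
qed

lemma parent_length: "parent e w \<Longrightarrow> length e = Suc n \<and> length w = n \<and> w \<in> B \<and> adj (hd w) (hd e)"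
  using length_child by (metis fresh_def parent_def)

lemma parent_child: "fresh w x \<Longrightarrow> parent (child w x) w"
  by (simp add: parent_def)

section \<open>Neighbours of the new vertices\<close>

lemma parents_related:
  assumes "parent e w" "parent e w'"
  shows "w = w' \<or> A w w' \<and> tri (hd w) (hd w') (hd e)"
  using assms child_eq_iff[of w "hd e" w'] unfolding parent_def same_child_def by simp

lemma parent_transfer:
  assumes "parent e w" "A w w'" "length w' = n" "tri (hd w) (hd w') (hd e)"
  shows "parent e w'"
  using assms fresh_transfer[of w "hd e" w'] child_eq_iff[of w "hd e" w']
  unfolding parent_def same_child_def by simp

lemma parent_inj: "parent e w \<Longrightarrow> parent e' w \<Longrightarrow> hd e = hd e' \<Longrightarrow> e = e'"
  by (metis parent_def)

lemma parent_new: "parent e w \<Longrightarrow> A w f \<Longrightarrow> hd f \<noteq> hd e"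
  by (auto simp: parent_def fresh_def)

lemma parent_not_B: "parent e w \<Longrightarrow> e \<notin> B"
  using parent_length level_le by fastforce

lemma parent_not_parent: "parent e w \<Longrightarrow> \<not> parent w u"
  using parent_length parent_not_B by blast

text \<open>Moves a sibling triangle from the parent \<open>u\<close> to another parent
  \<open>w\<close> of \<open>e\<close>, by flagness of the link of \<open>hd u\<close>.\<close>

lemma siblings_trans:
  assumes "parent e u" "parent f u" "tri (hd u) (hd e) (hd f)"
    and "parent e w"
  shows "w = u \<or> tri (hd u) (hd w) (hd f) \<longrightarrow> parent f w \<and> tri (hd w) (hd e) (hd f)"
proof (intro impI)
  assume a: "w = u \<or> tri (hd u) (hd w) (hd f)"
  show "parent f w \<and> tri (hd w) (hd e) (hd f)"
  proof (cases "w = u")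
    case True then show ?thesis using assms by simp
  next
    case False
    then have r: "A u w" "tri (hd u) (hd w) (hd e)" using parents_related[OF assms(1,4)] by auto
    have "parent f w" using parent_transfer[OF assms(2) r(1)] a False parent_length[OF assms(4)] by blast
    moreover have "tri (hd w) (hd e) (hd f)"
      using link_flag[of "hd u" "hd w" "hd e" "hd f"] r a False assms(3) by blast
    ultimately show ?thesis by blast
  qed
qed

lemma common_parent_tri:
  assumes "parent e u" "parent f u" "tri (hd u) (hd e) (hd f)" "parent e w" "parent f w"
  shows "tri (hd w) (hd e) (hd f)"
  using siblings_trans[OF assms(1-4)] parents_related[OF assms(2,5)] by blast

text \<open>Here flagness is used in the link of \<open>hd e\<close>, which contains the two parents
  and \<open>hd f\<close>.\<close>

lemma parent_of_tri:
  assumes "parent e u" "parent f u" "tri (hd u) (hd e) (hd f)" "parent e w"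
    and "tri (hd e) (hd w) (hd f)"
  shows "parent f w"
proof (cases "w = u")
  case False
  then have r: "A u w" "tri (hd u) (hd w) (hd e)" using parents_related[OF assms(1,4)] by auto
  have "tri (hd u) (hd w) (hd f)"
    using link_flag[of "hd e" "hd u" "hd w" "hd f"] r assms tri_perms by blast
  then show ?thesis using siblings_trans[OF assms(1-4)] by blast
qed (use assms in simp)

lemma siblings_unique:
  assumes "parent e u" "parent f u" "tri (hd u) (hd e) (hd f)"
    and "parent e u'" "parent f' u'" "tri (hd u') (hd e) (hd f')" and "hd f = hd f'"
  shows "f = f'"
proof -
  have "parent f u'" using parent_of_tri[OF assms(1-4)] assms(6,7) tri_perms by metis
  then show ?thesis using parent_inj assms by blast
qed

text \<open>If \<open>u\<close> and \<open>u'\<close> differ, then \<open>u\<close>,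
  \<open>f\<close>, \<open>f'\<close>, \<open>u'\<close> project to a 4-cycle in the link of
  \<open>hd e\<close>. One diagonal makes \<open>u\<close> a parent of \<open>f'\<close>, the other
  makes \<open>u'\<close> a parent of \<open>f\<close>; either way \<open>f\<close> and
  \<open>f'\<close> share a parent.\<close>

lemma siblings_tri_imp_sibling:
  assumes e: "parent e u" "parent f u" "tri (hd u) (hd e) (hd f)"
    "parent e u'" "parent f' u'" "tri (hd u') (hd e) (hd f')"
    and t: "tri (hd e) (hd f) (hd f')"
  shows "\<exists>w. parent f w \<and> parent f' w \<and> tri (hd w) (hd f) (hd f')"
proof -
  have step: "\<exists>w. parent f w \<and> parent f' w \<and> tri (hd w) (hd f) (hd f')"
    if "tri (hd e) (hd u) (hd f')"
  proof -
    have "parent f' u" using parent_of_tri[OF e(4,5,6) e(1)] that by blast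
    moreover have "tri (hd u) (hd f) (hd f')"
      using link_flag[of "hd e" "hd u" "hd f" "hd f'"] that e(3) t tri_perms by blast
    ultimately show ?thesis using e by blast
  qed
  have step': "\<exists>w. parent f w \<and> parent f' w \<and> tri (hd w) (hd f) (hd f')"
    if "tri (hd e) (hd u') (hd f)"
  proof -
    have "parent f u'" using parent_of_tri[OF e(1,2,3) e(4)] that by blast
    moreover have "tri (hd u') (hd f) (hd f')"
      using link_flag[of "hd e" "hd u'" "hd f" "hd f'"] that e(6) t tri_perms by blast
    ultimately show ?thesis using e by blast
  qed
  show ?thesis
  proof (cases "u = u'")
    case True then show ?thesis using step e tri_perms by metis
  next
    case False
    then have r: "A u u'" "tri (hd u) (hd u') (hd e)" using parents_related[OF e(1,4)] by auto
    have "hd u \<noteq> hd f'" using parent_new[OF e(5)] A_sym r(1) by metis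
    moreover have "hd f \<noteq> hd u'" using parent_new[OF e(2) r(1)] by metis
    ultimately have "tri (hd e) (hd u) (hd f') \<or> tri (hd e) (hd f) (hd u')"
      using link_square[of "hd e" "hd u" "hd f" "hd f'" "hd u'"] r e(3,6) t tri_perms by blast
    then show ?thesis using step step' tri_perms by blast
  qed
qed

text \<open>Vertices that are siblings in pairs have a parent common to all three, and there
  flagness gives the triangle. If the three given parents are distinct, they span a triangle, and a
  diagonal of the 4-cycle \<open>e\<close>, \<open>f\<close>, \<open>w\<close>, \<open>u'\<close> in
  the link of \<open>u\<close> makes \<open>w\<close> a parent of \<open>e\<close> or
  \<open>u'\<close> a parent of \<open>f\<close>.\<close>

lemma siblings_imp_tri:
  assumes a: "parent e u" "parent f u" "tri (hd u) (hd e) (hd f)"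
    and b: "parent e u'" "parent f' u'" "tri (hd u') (hd e) (hd f')"
    and c: "parent f w" "parent f' w" "tri (hd w) (hd f) (hd f')"
  shows "tri (hd e) (hd f) (hd f')"
proof -
  have final: "tri (hd e) (hd f) (hd f')" if "parent e z" "parent f z" "parent f' z" for z
    using common_parent_tri[OF a that(1,2)] common_parent_tri[OF b that(1,3)]
      common_parent_tri[OF c that(2,3)] link_flag[of "hd z" "hd e" "hd f" "hd f'"] by blast
  have r1: "u = u' \<or> A u u' \<and> tri (hd u) (hd u') (hd e)" by (rule parents_related[OF a(1) b(1)])
  have r2: "u = w \<or> A u w \<and> tri (hd u) (hd w) (hd f)" by (rule parents_related[OF a(2) c(1)])
  have r3: "u' = w \<or> A u' w \<and> tri (hd u') (hd w) (hd f')" by (rule parents_related[OF b(2) c(2)])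
  consider "u = u'" | "u = w" | "u' = w" | "u \<noteq> u'" "u \<noteq> w" "u' \<noteq> w" by blast
  then show ?thesis
  proof cases
    case 1 then show ?thesis using final a b by blast
  next
    case 2 then show ?thesis using final a c by blast
  next
    case 3 then show ?thesis using final b c by blast
  next
    case 4
    then have A: "A u u'" "A u w" "A u' w" using r1 r2 r3 by auto
    have t: "tri (hd u) (hd u') (hd w)" using lift_tri[OF A(1,2)] A(3) by blast
    have t1: "tri (hd u) (hd u') (hd e)" "tri (hd u) (hd w) (hd f)" using r1 r2 4 by auto
    have "hd e \<noteq> hd w" using parent_new[OF a(1) A(2)] by metis
    moreover have "hd f \<noteq> hd u'" using parent_new[OF a(2) A(1)] by metis
    ultimately have "tri (hd u) (hd e) (hd w) \<or> tri (hd u) (hd f) (hd u')"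
      using link_square[of "hd u" "hd e" "hd f" "hd w" "hd u'"] a(3) t t1 tri_perms by blast
    then show ?thesis
    proof
      assume "tri (hd u) (hd e) (hd w)"
      then have "parent e w" using parent_transfer[OF a(1) A(2)] parent_length[OF c(1)] tri_perms by blast
      then show ?thesis using final c by blast
    next
      assume "tri (hd u) (hd f) (hd u')"
      then have "parent f u'" using parent_transfer[OF a(2) A(1)] parent_length[OF b(1)] tri_perms by blast
      then show ?thesis using final b by blast
    qed
  qed
qed

lemma A'_has_parent: "A' e f \<Longrightarrow> e \<notin> B \<Longrightarrow> \<exists>u. parent e u"
  using A_mem parent_length unfolding A'_def by blast

lemma A'_new:
  assumes "parent e u"
  shows "A' e f \<longleftrightarrow> parent e f \<or> (\<exists>w. parent e w \<and> parent f w \<and> tri (hd w) (hd e) (hd f))"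
  using assms parent_not_parent parent_not_B A_mem unfolding A'_def by blast

lemma A'_old:
  assumes "e \<in> B"
  shows "A' e f \<longleftrightarrow> A e f \<or> parent f e"
  using assms parent_not_B unfolding A'_def by blast

lemma A'_sym: "A' e f \<Longrightarrow> A' f e"
  using A_sym tri_perms unfolding A'_def by metis

lemma A'_lift_unique:
  assumes "A' e f" "A' e f'" "hd f = hd f'"
  shows "f = f'"
proof (cases "e \<in> B")
  case True
  then show ?thesis using assms A'_old lift_unique parent_inj parent_new by metis
next
  case False
  then obtain u where u: "parent e u"
    using assms A'_has_parent by blast
  have mixed: False if "parent e p" "parent e w" "parent g w" "tri (hd w) (hd e) (hd g)" "hd p = hd g" for p w g
    using parents_related[OF that(2,1)] parent_new[OF that(3)] that tri_distinct by metis
  have "parent e f \<or> (\<exists>w. parent e w \<and> parent f w \<and> tri (hd w) (hd e) (hd f))"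
    "parent e f' \<or> (\<exists>w. parent e w \<and> parent f' w \<and> tri (hd w) (hd e) (hd f'))"
    using assms A'_new[OF u] by auto
  moreover have "f = f'" if "parent e f" "parent e f'"
    using parents_related[OF that] assms(3) A_adj adj_irrefl by metis
  ultimately show ?thesis using mixed siblings_unique assms(3) by metis
qed

lemma old_tri_aux:
  assumes "A e f" "parent f' e"
  shows "parent f' f \<longleftrightarrow> tri (hd e) (hd f) (hd f')"
proof
  assume "parent f' f"
  then show "tri (hd e) (hd f) (hd f')" using parents_related[OF assms(2)] assms A_irrefl by metis
next
  assume t: "tri (hd e) (hd f) (hd f')"
  have "\<not> length f < n" using fresh_no_tri_parent[of e "hd f'" f] assms t by (auto simp: parent_def)
  then have "length f = n" using level_le A_mem2[OF assms(1)] by fastforce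
  then show "parent f' f" using parent_transfer[OF assms(2,1)] t by blast
qed

text \<open>Cases by kind of neighbour: old or child for an old \<open>e\<close>, parent or sibling
  for a new one. Two siblings of a new vertex are the case that needs the 4-cycle arguments
  above.\<close>

lemma A'_lift_tri:
  assumes "A' e f" "A' e f'"
  shows "A' f f' \<longleftrightarrow> tri (hd e) (hd f) (hd f')"
proof (cases "e \<in> B")
  case e: True
  have c: "A' f f' \<longleftrightarrow> tri (hd e) (hd f) (hd f')" if "A e f" "parent f' e" for f f'
    using old_tri_aux[OF that] A_mem2[OF that(1)] A'_old[of f f'] parent_not_B[OF that(2)] A_mem2
    by blast
  consider "A e f" "A e f'" | "A e f" "parent f' e" | "parent f e" "A e f'" | "parent f e" "parent f' e"
    using assms A'_old[OF e] by blast
  then show ?thesis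
  proof cases
    case 1
    then show ?thesis using A'_old[of f f'] lift_tri A_mem2 parent_not_B by blast
  next
    case 2 then show ?thesis using c by blast
  next
    case 3 then show ?thesis using c[of f' f] A'_sym tri_perms by metis
  next
    case 4
    show ?thesis
    proof
      assume "A' f f'"
      then obtain w where "parent f w" "parent f' w" "tri (hd w) (hd f) (hd f')"
        using A'_new[OF 4(1)] parent_not_parent 4 by blast
      then show "tri (hd e) (hd f) (hd f')" using common_parent_tri 4 by blast
    next
      assume "tri (hd e) (hd f) (hd f')"
      then show "A' f f'" using 4 unfolding A'_def by blast
    qed
  qed
next
  case False
  then obtain u where u: "parent e u"
    using assms A'_has_parent by blast
  let ?S = "\<lambda>e f. \<exists>w. parent e w \<and> parent f w \<and> tri (hd w) (hd e) (hd f)"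
  have pp: "A' p q \<longleftrightarrow> tri (hd e) (hd p) (hd q)" if "parent e p" "parent e q" for p q
  proof (cases "p = q")
    case True
    then show ?thesis using that A'_old A_irrefl parent_length parent_not_B tri_distinct by metis
  next
    case F: False
    then show ?thesis using parents_related[OF that] tri_perms unfolding A'_def by blast
  qed
  have ps: "A' p g \<longleftrightarrow> tri (hd e) (hd p) (hd g)" if p: "parent e p" and eg: "?S e g" for p g
  proof -
    obtain w where w: "parent e w" "parent g w" "tri (hd w) (hd e) (hd g)" using eg by blast
    have "A' p g \<longleftrightarrow> parent g p"
      using A'_old[of p g] parent_length[OF p] parent_not_B[OF w(2)] A_mem2 by blast
    also have "\<dots> \<longleftrightarrow> tri (hd e) (hd p) (hd g)"
      using common_parent_tri[OF w p] parent_of_tri[OF w p] tri_perms by blast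
    finally show ?thesis .
  qed
  have "?S g h \<longleftrightarrow> tri (hd e) (hd g) (hd h)" if "?S e g" "?S e h" for g h
    using that siblings_imp_tri siblings_tri_imp_sibling by meson
  moreover have "A' g h \<longleftrightarrow> ?S g h" if "?S e g" "?S e h" for g h
    using that A'_new parent_not_parent by blast
  ultimately have ss: "A' g h \<longleftrightarrow> tri (hd e) (hd g) (hd h)" if "?S e g" "?S e h" for g h
    using that by blast
  consider "parent e f" "parent e f'" | "parent e f" "?S e f'" | "?S e f" "parent e f'" | "?S e f" "?S e f'"
    using assms A'_new[OF u] by blast
  then show ?thesis
  proof cases
    case 1 then show ?thesis by (rule pp)
  next
    case 2 then show ?thesis by (rule ps)
  next
    case 3 then show ?thesis using ps[of f' f] A'_sym tri_perms by metis
  next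
    case 4 then show ?thesis by (rule ss)
  qed
qed

text \<open>The projection property comes for free: adjacent new vertices share a parent by
  definition of \<open>A'\<close>, and two parents of one new vertex are adjacent by
  \<open>parents_related\<close>.\<close>

lemma partial_cover_extend: "partial_cover adj tri r B' A' (Suc n)"
proof unfold_locales
  show "[r] \<in> B'" using root_mem by (simp add: B'_def)
next
  fix e assume "e \<in> B'"
  then show "1 \<le> length e"
    using level_pos parent_length unfolding B'_def by fastforce
next
  have "1 \<le> n" using level_le[OF root_mem] by simp
  then show "e \<in> B' \<Longrightarrow> length e = 1 \<Longrightarrow> e = [r]" for e
    using level_one parent_length unfolding B'_def by fastforce
next
  fix e assume "e \<in> B'"
  then show "length e \<le> Suc n"
    using level_le parent_length unfolding B'_def by fastforce
next
  fix e f assume "A' e f"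
  then show "e \<in> B'" using A_mem parent_length unfolding A'_def B'_def by blast
next
  fix e f assume "A' e f" then show "A' f e" by (rule A'_sym)
next
  fix e f assume "A' e f"
  then show "adj (hd e) (hd f)"
    using A_adj parent_length adj_sym tri_adj tri_perms unfolding A'_def by blast
next
  fix e f assume "A' e f"
  then show "length f \<le> Suc (length e)"
    using A_level parent_length unfolding A'_def by fastforce
next
  fix e f f' assume "A' e f" "A' e f'" "hd f = hd f'" then show "f = f'" by (rule A'_lift_unique)
next
  fix e f f' assume "A' e f" "A' e f'"
  then show "A' f f' \<longleftrightarrow> tri (hd e) (hd f) (hd f')" by (rule A'_lift_tri)
next
  fix e x assume e: "e \<in> B'" "length e < Suc n" "adj (hd e) x"
  have eB: "e \<in> B" using e parent_length unfolding B'_def by fastforce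
  show "\<exists>f. A' e f \<and> hd f = x"
  proof (cases "\<exists>f. A e f \<and> hd f = x")
    case True then show ?thesis unfolding A'_def by blast
  next
    case False
    then have "length e = n" using lift_exists eB e by fastforce
    then have "fresh e x" using False eB e by (auto simp: fresh_def)
    then show ?thesis using parent_child hd_child A'_old[OF eB] by blast
  qed
next
  fix e p q assume a: "A' e p" "A' e q" "length e = Suc (length p)" "length e = Suc (length q)"
  show "p = q \<or> A' p q"
  proof (cases "e \<in> B")
    case True
    have "A e g" if "A' e g" "length e = Suc (length g)" for g
      using that A'_old[OF True] parent_length[of g e] by auto
    then have "A e p" "A e q" using a by simp_all
    then have "p = q \<or> A p q" using parents_clique[of e p q] a by blast
    then show ?thesis unfolding A'_def by blast
  next
    case False
    then obtain u where u: "parent e u" using a A'_has_parent by blast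
    have "parent e g" if "A' e g" "length e = Suc (length g)" for g
      using that A'_new[OF u, of g] parent_length[OF u] parent_length by (metis n_not_Suc_n)
    then have "parent e p" "parent e q" using a by simp_all
    then have "p = q \<or> A p q" using parents_related[of e p q] by blast
    then show ?thesis unfolding A'_def by auto
  qed
next
  fix e f assume a: "A' e f" "length e = length f"
  show "\<exists>p. A' e p \<and> A' f p \<and> length e = Suc (length p)"
  proof (cases "e \<in> B")
    case True
    then have "A e f" using a A'_old[OF True] parent_length[of f e] by auto
    then obtain p where "A e p" "A f p" "length e = Suc (length p)"
      using common_parent[of e f] a by blast
    then show ?thesis unfolding A'_def by blast
  next
    case False
    then obtain u where u: "parent e u" using a A'_has_parent by blast
    obtain w where "parent e w" "parent f w"
      using a A'_new[OF u] parent_length[OF u] parent_length[of e f] by auto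
    moreover from this have "length e = Suc (length w)" using parent_length[of e w] by simp
    ultimately show ?thesis unfolding A'_def by blast
  qed
next
  fix e assume a: "e \<in> B'" "1 < length e"
  then show "\<exists>p. A' e p \<and> length e = Suc (length p)"
    using parent_exists[of e] parent_length[of e] unfolding A'_def B'_def by fastforce
qed

lemma A'_restrict: "e \<in> B \<Longrightarrow> f \<in> B \<Longrightarrow> A' e f \<longleftrightarrow> A e f"
  using A'_old parent_not_B by blast

end

locale total_cover = graded_cover adj tri r B A
  for adj :: "'v \<Rightarrow> 'v \<Rightarrow> bool" and tri r B A +
  assumes lift_exists: "\<lbrakk>e \<in> B; adj (hd e) x\<rbrakk> \<Longrightarrow> \<exists>f. A e f \<and> hd f = x"

section \<open>The union of all balls\<close>

context locally_six_large
begin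

text \<open>The root is on level 1, so \<open>stage r n\<close> is the ball of levels 1 to
  \<open>Suc n\<close>.\<close>

primrec stage :: "'v \<Rightarrow> nat \<Rightarrow> 'v list set \<times> ('v list \<Rightarrow> 'v list \<Rightarrow> bool)" where
  "stage r 0 = ({[r]}, \<lambda>_ _. False)"
| "stage r (Suc n) =
    (partial_cover.B' adj tri (fst (stage r n)) (snd (stage r n)) (Suc n),
     partial_cover.A' adj tri (fst (stage r n)) (snd (stage r n)) (Suc n))"

lemma stage_cover: "partial_cover adj tri r (fst (stage r n)) (snd (stage r n)) (Suc n)"
proof (induction n)
  case 0
  show ?case by unfold_locales auto
next
  case (Suc n)
  then interpret partial_cover adj tri r "fst (stage r n)" "snd (stage r n)" "Suc n" .
  show ?case using partial_cover_extend by simp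
qed

definition cover_vertices :: "'v \<Rightarrow> 'v list set" where
  "cover_vertices r = (\<Union>n. fst (stage r n))"

definition cover_adj :: "'v \<Rightarrow> 'v list \<Rightarrow> 'v list \<Rightarrow> bool" where
  "cover_adj r e f \<longleftrightarrow> (\<exists>n. snd (stage r n) e f)"

lemma stage_mono: 
  assumes "m \<le> n"
  shows "fst (stage r m) \<subseteq> fst (stage r n) \<and> (\<forall>e f. snd (stage r m) e f \<longrightarrow> snd (stage r n) e f)"
  using assms
proof (induction n rule: dec_induct)
  case (step n)
  interpret partial_cover adj tri r "fst (stage r n)" "snd (stage r n)" "Suc n" by (rule stage_cover)
  show ?case using step.IH by (auto simp: B'_def A'_def)
qed simp

text \<open>Later stages add no edges between vertices already present; otherwise the equivalence
  \<open>lift_tri\<close> might fail in the union.\<close>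

lemma stage_restrict:
  assumes "m \<le> n" "e \<in> fst (stage r m)" "f \<in> fst (stage r m)" "snd (stage r n) e f"
  shows "snd (stage r m) e f"
  using assms(1,4)
proof (induction n rule: dec_induct)
  case (step n)
  interpret partial_cover adj tri r "fst (stage r n)" "snd (stage r n)" "Suc n" by (rule stage_cover)
  have "e \<in> fst (stage r n)" "f \<in> fst (stage r n)" using stage_mono[OF step.hyps(1)] assms by blast+
  then show ?case using step.IH step.prems A'_restrict by simp
qed simp

lemma cover_adj_stage: 
  assumes "cover_adj r e f" "cover_adj r e' f'"
  shows "\<exists>n. snd (stage r n) e f \<and> snd (stage r n) e' f'"
proof -
  obtain m n where "snd (stage r m) e f" "snd (stage r n) e' f'"
    using assms by (auto simp: cover_adj_def)
  then have "snd (stage r (max m n)) e f \<and> snd (stage r (max m n)) e' f'"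
    using stage_mono[of m "max m n"] stage_mono[of n "max m n"] by auto
  then show ?thesis by blast
qed

lemma total_cover: "total_cover adj tri r (cover_vertices r) (cover_adj r)"
proof unfold_locales
  have pc: "partial_cover adj tri r (fst (stage r n)) (snd (stage r n)) (Suc n)" for n
    by (rule stage_cover)
  have gc: "graded_cover adj tri r (fst (stage r n)) (snd (stage r n))" for n
    by (rule partial_cover.axioms(1)[OF pc])
  show "[r] \<in> cover_vertices r" using graded_cover.root_mem[OF gc] by (auto simp: cover_vertices_def)
  show "e \<in> cover_vertices r \<Longrightarrow> 1 \<le> length e" for e
    using graded_cover.level_pos[OF gc] by (auto simp: cover_vertices_def)
  show "e \<in> cover_vertices r \<Longrightarrow> length e = 1 \<Longrightarrow> e = [r]" for e
    using graded_cover.level_one[OF gc] by (auto simp: cover_vertices_def)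
  show "cover_adj r e f \<Longrightarrow> e \<in> cover_vertices r" for e f
    using graded_cover.A_mem[OF gc] by (auto simp: cover_vertices_def cover_adj_def)
  show "cover_adj r e f \<Longrightarrow> cover_adj r f e" for e f
    using graded_cover.A_sym[OF gc] by (auto simp: cover_adj_def)
  show "cover_adj r e f \<Longrightarrow> adj (hd e) (hd f)" for e f
    using graded_cover.A_adj[OF gc] by (auto simp: cover_adj_def)
  show "cover_adj r e f \<Longrightarrow> length f \<le> Suc (length e)" for e f
    using graded_cover.A_level[OF gc] by (auto simp: cover_adj_def)
  show "\<lbrakk>cover_adj r e f; cover_adj r e f'; hd f = hd f'\<rbrakk> \<Longrightarrow> f = f'" for e f f'
    using graded_cover.lift_unique[OF gc] cover_adj_stage by metis
  show "cover_adj r f f' \<longleftrightarrow> tri (hd e) (hd f) (hd f')"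
    if ef: "cover_adj r e f" "cover_adj r e f'" for e f f'
  proof -
    obtain n where n: "snd (stage r n) e f" "snd (stage r n) e f'"
      using cover_adj_stage[OF ef] by blast
    have mem: "f \<in> fst (stage r n)" "f' \<in> fst (stage r n)"
      using graded_cover.A_mem2[OF gc] n by blast+
    have "cover_adj r f f' \<longleftrightarrow> snd (stage r n) f f'"
    proof
      assume "cover_adj r f f'"
      then obtain m where "snd (stage r m) f f'" by (auto simp: cover_adj_def)
      then have "snd (stage r (max m n)) f f'" using stage_mono[of m "max m n"] by auto
      then show "snd (stage r n) f f'" using stage_restrict[of n "max m n"] mem by auto
    qed (auto simp: cover_adj_def)
    then show ?thesis using graded_cover.lift_tri[OF gc n] by simp
  qed
  show "p = q \<or> cover_adj r p q"
    if "cover_adj r e p" "cover_adj r e q" "length e = Suc (length p)" "length e = Suc (length q)" for e p q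
    using cover_adj_stage[OF that(1,2)] graded_cover.parents_clique[OF gc _ _ that(3,4)]
    unfolding cover_adj_def by blast
  show "\<exists>p. cover_adj r e p \<and> cover_adj r f p \<and> length e = Suc (length p)"
    if "cover_adj r e f" "length e = length f" for e f
    using that(1) graded_cover.common_parent[OF gc _ that(2)]
    unfolding cover_adj_def by blast
  show "\<exists>p. cover_adj r e p \<and> length e = Suc (length p)"
    if "e \<in> cover_vertices r" "1 < length e" for e
    using that(1) graded_cover.parent_exists[OF gc _ that(2)]
    unfolding cover_adj_def cover_vertices_def by blast
  show "\<exists>f. cover_adj r e f \<and> hd f = x" if e: "e \<in> cover_vertices r" "adj (hd e) x" for e x
  proof -
    obtain m where m: "e \<in> fst (stage r m)" using e(1) by (auto simp: cover_vertices_def)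
    \<comment> \<open>At stage \<open>m\<close> the vertex may still be on the boundary; one stage
      later it is interior.\<close>
    have "length e \<le> Suc m" using partial_cover.level_le[OF pc m] .
    then show ?thesis
      using partial_cover.lift_exists[OF pc[of "Suc m"], of e x] stage_mono[of m "Suc m"] m e(2)
      unfolding cover_adj_def by (meson le_SucI le_imp_less_Suc order_refl subset_iff)
  qed
qed

end

context total_cover
begin

text \<open>A Helly-type induction on the size of \<open>S\<close>. Omitting \<open>a\<close> and
  omitting \<open>b\<close> gives common parents \<open>p\<close> and \<open>q\<close> of the rest.
  If they differ, \<open>a\<close>, \<open>b\<close>, \<open>p\<close>, \<open>q\<close> project to
  a 4-cycle in the link of a third member \<open>c\<close>, and either diagonal makes one of the two
  a parent of all of \<open>S\<close>.\<close>

lemma clique_common_parent: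
  assumes "finite S" "S \<noteq> {}" "S \<subseteq> B" "\<And>e. e \<in> S \<Longrightarrow> length e = Suc n" "1 \<le> n"
    and "\<And>e f. e \<in> S \<Longrightarrow> f \<in> S \<Longrightarrow> e \<noteq> f \<Longrightarrow> A e f"
  shows "\<exists>p. length p = n \<and> (\<forall>e\<in>S. A e p)"
  using assms
proof (induction "card S" arbitrary: S rule: less_induct)
  case less
  show ?case
  proof (cases "\<exists>a b. S \<subseteq> {a, b}")
    case True
    then obtain a b where ab: "a \<in> S" "b \<in> S" "S \<subseteq> {a, b}"
      using less.prems(2) by blast
    show ?thesis
    proof (cases "a = b")
      case True
      then show ?thesis using parent_exists[of a] ab less.prems by fastforce
    next
      case False
      then show ?thesis using common_parent[of a b] ab less.prems(4,6) by fastforce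
    qed
  next
    case False
    obtain a where a: "a \<in> S" using less.prems(2) by blast
    obtain b where b: "b \<in> S" "b \<noteq> a" using False a by blast
    obtain c where c: "c \<in> S" "c \<noteq> a" "c \<noteq> b" using False by blast
    have sub: "\<exists>p. length p = n \<and> (\<forall>e\<in>S - {z}. A e p)" if "z \<in> S" for z
    proof (rule less.hyps)
      show "card (S - {z}) < card S" using card_Diff1_less[OF less.prems(1) that] .
      show "S - {z} \<noteq> {}" using False by blast
    qed (use less.prems in auto)
    obtain p where p: "length p = n" "\<forall>e\<in>S - {a}. A e p" using sub a by blast
    obtain q where q: "length q = n" "\<forall>e\<in>S - {b}. A e q" using sub b by blast
    have cc: "A c a" "A c b" "A c p" "A c q" "A a b" "A b p" "A a q"
      using a b c p q less.prems(6) by auto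
    have len: "length a = Suc n" "length b = Suc n" "length c = Suc n"
      using a b c less.prems(4) by auto
    show ?thesis
    proof (cases "p = q")
      case True
      then have "\<forall>e\<in>S. A e p" using p q b by blast
      then show ?thesis using p by blast
    next
      case False
      then have pq: "A p q" using parents_clique[OF cc(3,4)] len p q by simp
      have "a \<noteq> p" "b \<noteq> q" using len p q by auto
      then have "hd a \<noteq> hd p" "hd b \<noteq> hd q" using lift_unique cc by blast+
      moreover have "tri (hd c) (hd a) (hd b)" "tri (hd c) (hd b) (hd p)"
        "tri (hd c) (hd p) (hd q)" "tri (hd c) (hd q) (hd a)"
        using lift_tri[OF cc(1,2)] lift_tri[OF cc(2,3)] lift_tri[OF cc(3,4)] lift_tri[OF cc(4,1)]
          cc pq A_sym by blast+
      ultimately have "tri (hd c) (hd a) (hd p) \<or> tri (hd c) (hd b) (hd q)"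
        using link_square by blast
      then have "A a p \<or> A b q" using lift_tri[OF cc(1,3)] lift_tri[OF cc(2,4)] by blast
      then have "(\<forall>e\<in>S. A e p) \<or> (\<forall>e\<in>S. A e q)" using p q by blast
      then show ?thesis using p q by blast
    qed
  qed
qed

end

lemma systolic_locally_six_large:
  assumes X: "simplicial_complex X" and large: "locally_k_large 6 X"
  shows "locally_six_large (edge_rel X) (triangle_rel X)"
proof
  show "edge_rel X x y \<Longrightarrow> edge_rel X y x" for x y by (auto simp: edge_rel_def insert_commute)
  show "\<not> edge_rel X x x" for x by (simp add: edge_rel_def)
  show "triangle_rel X x y z \<Longrightarrow> triangle_rel X y z x" for x y z
    by (auto simp: triangle_rel_def insert_commute)
  show swap: "triangle_rel X x y z \<Longrightarrow> triangle_rel X y x z" for x y z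
    by (auto simp: triangle_rel_def insert_commute)
  show "edge_rel X x y" if "triangle_rel X x y z" for x y z
  proof -
    have "{x, y, z} \<in> X" using that by (simp add: triangle_rel_def)
    then have "{x, y} \<in> X" by (rule simplex_face[OF X]) auto
    then show ?thesis using that by (simp add: edge_rel_def triangle_rel_def)
  qed
  have sw: "triangle_rel X x y z \<longleftrightarrow> triangle_rel X x z y" for x y z
    by (auto simp: triangle_rel_def insert_commute)
  have irr: "\<not> triangle_rel X x y y" for x y by (simp add: triangle_rel_def)
  have kl: "k_large 6 (link X v)" if "triangle_rel X v a b" for v a b
  proof -
    have "v \<in> \<Union>X" using that by (auto simp: triangle_rel_def)
    then show ?thesis using large unfolding locally_k_large_def by (rule bspec[rotated])
  qed
  show "triangle_rel X a b c"
    if t: "triangle_rel X v a b" "triangle_rel X v b c" "triangle_rel X v a c" for v a b c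
  proof -
    have ed: "{a, b} \<in> edges (link X v)" "{b, c} \<in> edges (link X v)" "{a, c} \<in> edges (link X v)"
      using t link_edge[OF X] by blast+
    then have "{a, b, c} \<subseteq> \<Union>(link X v)" by (auto simp: edges_def)
    moreover have "\<forall>u\<in>{a, b, c}. \<forall>w\<in>{a, b, c}. u \<noteq> w \<longrightarrow> {u, w} \<in> edges (link X v)"
      using ed by (auto simp: insert_commute)
    moreover have "flag_complex (link X v)" using kl[OF t(1)] by (simp add: k_large_def)
    note mp[OF spec[OF this[unfolded flag_complex_def], of "{a, b, c}"]]
    ultimately have "{a, b, c} \<in> link X v" by simp
    then show ?thesis using t by (auto simp: link_def triangle_rel_def)
  qed
  show "triangle_rel X v a c \<or> triangle_rel X v b d"
    if t: "triangle_rel X v a b" "triangle_rel X v b c" "triangle_rel X v c d" "triangle_rel X v d a"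
      "a \<noteq> c" "b \<noteq> d" for v a b c d
  proof -
    let ?w = "\<lambda>i. [a, b, c, d, a] ! i"
    have dist: "a \<noteq> b" "b \<noteq> c" "c \<noteq> d" "d \<noteq> a" using t by (auto simp: triangle_rel_def)
    have four: "{..<4} = {0, 1, 2, 3::nat}" by auto
    have ed: "edges (cycle_complex 4 ?w) = {{a, b}, {b, c}, {c, d}, {d, a}}"
      using dist by (auto simp: edges_def cycle_complex_def four card_insert_if)
    have len: "card (edges (cycle_complex 4 ?w)) = 4"
      unfolding ed using dist t(5,6) by (auto simp: card_insert_if doubleton_eq_iff)
    have inj: "inj_on ?w {..<4}"
      using dist t(5,6) by (auto simp: four inj_on_def)
    have tri: "triangle_rel X v (?w i) (?w (Suc i))" if "i < 4" for i
    proof -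
      have "i \<in> {0, 1, 2, 3}" using that four by blast
      then show ?thesis using t by auto
    qed
    obtain i j where ij: "i < 4" "j < 4" "triangle_rel X v (?w i) (?w j)" "{?w i, ?w j} \<notin> edges (cycle_complex 4 ?w)"
      using link_cycle_diagonal[OF X kl[OF t(1)] _ _ inj _ tri len] by auto
    have "i \<in> {0, 1, 2, 3}" "j \<in> {0, 1, 2, 3}" using ij four by blast+
    \<comment> \<open>Equal indices are excluded by \<open>irr\<close>, neighbouring ones by the
      edge list; what remains is a genuine diagonal.\<close>
    then show ?thesis using ij(3,4) unfolding ed
      by (elim insertE emptyE) (simp_all add: insert_commute sw irr)
  qed
  show "triangle_rel X v a c \<or> triangle_rel X v b d \<or> triangle_rel X v c e \<or> triangle_rel X v d a \<or> triangle_rel X v e b"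
    if t: "triangle_rel X v a b" "triangle_rel X v b c" "triangle_rel X v c d" "triangle_rel X v d e"
      "triangle_rel X v e a" "distinct [a, b, c, d, e]" for v a b c d e
  proof -
    let ?w = "\<lambda>i. [a, b, c, d, e, a] ! i"
    have five: "{..<5} = {0, 1, 2, 3, 4::nat}" by auto
    have ed: "edges (cycle_complex 5 ?w) = {{a, b}, {b, c}, {c, d}, {d, e}, {e, a}}"
      using t(6) by (auto simp: edges_def cycle_complex_def five card_insert_if)
    have len: "card (edges (cycle_complex 5 ?w)) = 5"
      unfolding ed using t(6) by (auto simp: card_insert_if doubleton_eq_iff)
    have inj: "inj_on ?w {..<5}"
      using t(6) by (auto simp: five inj_on_def)
    have tri: "triangle_rel X v (?w i) (?w (Suc i))" if "i < 5" for i
    proof -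
      have "i \<in> {0, 1, 2, 3, 4}" using that five by blast
      then show ?thesis using t by auto
    qed
    obtain i j where ij: "i < 5" "j < 5" "triangle_rel X v (?w i) (?w j)" "{?w i, ?w j} \<notin> edges (cycle_complex 5 ?w)"
      using link_cycle_diagonal[OF X kl[OF t(1)] _ _ inj _ tri len] by auto
    have "i \<in> {0, 1, 2, 3, 4}" "j \<in> {0, 1, 2, 3, 4}" using ij five by blast+
    then show ?thesis using ij(3,4) unfolding ed
      by (elim insertE emptyE) (simp_all add: insert_commute sw irr)
  qed
qed

text \<open>The open stars of the vertices in \<open>S\<close> and those of the other vertices have
  disjoint unions, since a common point would yield an edge leaving \<open>S\<close>.\<close>

lemma connected_edge_closed:
  assumes X: "simplicial_complex X" and con: "connected_space (geometric_realization X)"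
    and S: "S \<subseteq> \<Union>X" "S \<noteq> {}" and cl: "\<And>x y. x \<in> S \<Longrightarrow> {x, y} \<in> X \<Longrightarrow> y \<in> S"
  shows "S = \<Union>X"
proof (rule ccontr)
  assume "S \<noteq> \<Union>X"
  then obtain b where b: "b \<in> \<Union>X" "b \<notin> S" using S by blast
  obtain a where a: "a \<in> S" using S by blast
  let ?R = "geometric_realization X"
  define U where "U = (\<Union>v\<in>S. {t \<in> topspace ?R. t v \<noteq> 0})"
  define V where "V = (\<Union>v\<in>-S. {t \<in> topspace ?R. t v \<noteq> 0})"
  have "openin ?R U" "openin ?R V" unfolding U_def V_def by (auto intro!: openin_Union openin_star)
  moreover have "topspace ?R \<subseteq> U \<union> V"
    using support_nonempty unfolding U_def V_def by fast
  moreover have "U \<inter> V = {}"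
  proof (rule ccontr)
    assume "U \<inter> V \<noteq> {}"
    then obtain t x y where "t \<in> topspace ?R" "x \<in> S" "y \<notin> S" "t x \<noteq> 0" "t y \<noteq> 0"
      unfolding U_def V_def by blast
    then have "{x, y} \<in> X" using support_simplex[OF X, of t "{x, y}"] by simp
    then show False using cl \<open>x \<in> S\<close> \<open>y \<notin> S\<close> by blast
  qed
  moreover have "vertex_point v \<in> topspace ?R" if v: "v \<in> \<Union>X" for v
  proof -
    obtain s where "s \<in> X" "v \<in> s" using v by blast
    moreover from this have "finite s" using X by (simp add: simplicial_complex_def)
    ultimately show ?thesis using vertex_point_mem by (fastforce simp: topspace_geometric_realization)
  qed
  then have "vertex_point a \<in> U" "vertex_point b \<in> V"
    using a b S(1) unfolding U_def V_def by (auto simp: vertex_point_def)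
  ultimately show False using con unfolding connected_space_def by blast
qed

section \<open>Directed geodesics\<close>

text \<open>The properties of the cover in terms of a graph with levels. Local finiteness keeps sets
  of common parents finite, hence cliques.\<close>

locale leveled_graph =
  fixes adj :: "'v \<Rightarrow> 'v \<Rightarrow> bool" and V :: "'v set" and lev :: "'v \<Rightarrow> nat"
  assumes adj_sym: "adj x y \<Longrightarrow> adj y x"
    and adj_irrefl: "\<not> adj x x"
    and adj_V: "adj x y \<Longrightarrow> x \<in> V"
    and adj_lev: "adj x y \<Longrightarrow> lev y \<le> Suc (lev x)"
    and lev_pos: "x \<in> V \<Longrightarrow> 1 \<le> lev x"
    and clique_common_parent:
      "\<lbrakk>finite S; S \<noteq> {}; S \<subseteq> V; \<And>x. x \<in> S \<Longrightarrow> lev x = Suc n; 1 \<le> n;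
        \<And>x y. \<lbrakk>x \<in> S; y \<in> S; x \<noteq> y\<rbrakk> \<Longrightarrow> adj x y\<rbrakk> \<Longrightarrow> \<exists>p. lev p = n \<and> (\<forall>x\<in>S. adj x p)"
    and parents_clique: "\<lbrakk>adj x p; adj x q; lev x = Suc (lev p); lev x = Suc (lev q)\<rbrakk> \<Longrightarrow> p = q \<or> adj p q"
    and locally_finite: "finite {y. adj x y}"
begin

definition clique :: "'v set \<Rightarrow> bool" where
  "clique S \<longleftrightarrow> finite S \<and> S \<noteq> {} \<and> S \<subseteq> V \<and> (\<forall>x\<in>S. \<forall>y\<in>S. x \<noteq> y \<longrightarrow> adj x y)"

definition parents :: "nat \<Rightarrow> 'v set \<Rightarrow> 'v set" where
  "parents n S = {p. lev p = n \<and> (\<forall>x\<in>S. adj x p)}"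

text \<open>In the notation of Januszkiewicz and Swiatkowski the last condition says that the intersection
  of the residue of \<open>T\<close> with the 1-ball around \<open>P\<close> is contained in \<open>S\<close>.\<close>
definition directed :: "'v set \<Rightarrow> 'v set \<Rightarrow> 'v set \<Rightarrow> bool" where
  "directed P S T \<longleftrightarrow> clique T \<and> (\<forall>s\<in>S. \<forall>t\<in>T. adj s t) \<and>
     (\<forall>w. (\<forall>t\<in>T. w = t \<or> adj w t) \<and> (\<exists>p\<in>P. w = p \<or> adj w p) \<longrightarrow> w \<in> S)"

lemma parents_nonempty:
  assumes "clique S" "\<forall>x\<in>S. lev x = Suc n" "1 \<le> n"
  shows "parents n S \<noteq> {}"
  using clique_common_parent[of S n] assms by (auto simp: clique_def parents_def)

lemma clique_insert:
  assumes "clique S" "x \<in> V" "\<And>s. s \<in> S \<Longrightarrow> s \<noteq> x \<Longrightarrow> adj s x"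
  shows "clique (insert x S)"
  using assms adj_sym unfolding clique_def by (simp add: insert_subset)

lemma parents_clique_set:
  assumes "clique S" "\<forall>x\<in>S. lev x = Suc n" "1 \<le> n"
  shows "clique (parents n S)"
proof -
  obtain x where x: "x \<in> S" using assms(1) by (auto simp: clique_def)
  have "parents n S \<subseteq> {y. adj x y}" using x by (auto simp: parents_def)
  then have "finite (parents n S)" using locally_finite finite_subset by blast
  moreover have "parents n S \<subseteq> V"
  proof
    fix p assume "p \<in> parents n S"
    then have "adj x p" using x by (simp add: parents_def)
    then show "p \<in> V" by (rule adj_V[OF adj_sym])
  qed
  moreover have pq: "p = q \<or> adj p q" if "p \<in> parents n S" "q \<in> parents n S" for p q
  proof (rule parents_clique)
    show "adj x p" "adj x q" "lev x = Suc (lev p)" "lev x = Suc (lev q)"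
      using that x assms(2) by (simp_all add: parents_def)
  qed
  ultimately show ?thesis
    using parents_nonempty[OF assms] unfolding clique_def
    by (intro conjI ballI impI) (simp_all, use pq in auto)
qed

text \<open>The step from local to global. A member of \<open>T\<close> has level \<open>n\<close>,
  \<open>Suc n\<close> or \<open>Suc (Suc n)\<close>; in the first two cases it would be equal or
  adjacent to a common parent of \<open>S\<close>. Conversely, a common parent \<open>q\<close> of
  \<open>T\<close> forms a clique with \<open>S\<close>; a common parent of that clique is one of
  \<open>S\<close> as well, and the condition at \<open>S\<close> absorbs \<open>q\<close>.\<close>

lemma directed_step:
  assumes S: "clique S" "\<forall>s\<in>S. lev s = Suc n" and n: "1 \<le> n"
    and d: "directed (parents n S) S T"
  shows "\<forall>t\<in>T. lev t = Suc (Suc n)" "S = parents (Suc n) T"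
proof -
  have T: "clique T" "\<And>s t. s \<in> S \<Longrightarrow> t \<in> T \<Longrightarrow> adj s t" using d by (auto simp: directed_def)
  have loc: "w \<in> S" if "\<And>t. t \<in> T \<Longrightarrow> w = t \<or> adj w t" "p \<in> parents n S" "w = p \<or> adj w p" for w p
    using d that unfolding directed_def by blast
  obtain s where s: "s \<in> S" using S by (auto simp: clique_def)
  show lev: "\<forall>t\<in>T. lev t = Suc (Suc n)"
  proof
    fix t assume t: "t \<in> T"
    \<comment> \<open>Such a \<open>t\<close> would belong to \<open>S\<close> and hence be adjacent
      to itself.\<close>
    have away: False if "p \<in> parents n S" "t = p \<or> adj t p" for p
    proof -
      have "t = u \<or> adj t u" if "u \<in> T" for u using T(1) t that by (auto simp: clique_def)
      then have "t \<in> S" using loc[of t p] that by blast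
      then show False using T(2)[of t t] t adj_irrefl by blast
    qed
    have "lev t \<le> Suc (Suc n)" "Suc n \<le> Suc (lev t)"
      using adj_lev[OF T(2)[OF s t]] adj_lev[OF adj_sym[OF T(2)[OF s t]]] S(2) s by auto
    moreover have "lev t \<noteq> n"
      using away[of t] T(2) t by (auto simp: parents_def)
    moreover have "lev t \<noteq> Suc n"
    proof
      assume "lev t = Suc n"
      moreover have "clique (insert t S)"
      proof (rule clique_insert[OF S(1)])
        show "t \<in> V" using T(1) t by (auto simp: clique_def)
      qed (rule T(2)[OF _ t])
      ultimately obtain p where "p \<in> parents n (insert t S)"
        using parents_nonempty[of "insert t S" n] S(2) n by auto
      then show False using away[of p] by (auto simp: parents_def)
    qed
    ultimately show "lev t = Suc (Suc n)" by linarith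
  qed
  show "S = parents (Suc n) T"
  proof
    show "S \<subseteq> parents (Suc n) T" using S(2) T(2) adj_sym by (auto simp: parents_def)
    show "parents (Suc n) T \<subseteq> S"
    proof
      fix q assume q: "q \<in> parents (Suc n) T"
      obtain t where t: "t \<in> T" using T(1) by (auto simp: clique_def)
      have qt: "adj t q" "lev q = Suc n" using q t by (auto simp: parents_def)
      have "s = q \<or> adj s q" if "s \<in> S" for s
        using parents_clique[of t s q] adj_sym[OF T(2)[OF that t]] qt lev t S(2) that by auto
      then have "clique (insert q S)"
        using clique_insert[OF S(1), of q] adj_V adj_sym qt by blast
      then obtain p where p: "p \<in> parents n (insert q S)"
        using parents_nonempty[of "insert q S" n] S(2) n qt by auto
      have "q = u \<or> adj q u" if "u \<in> T" for u using q that adj_sym by (auto simp: parents_def)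
      moreover have "p \<in> parents n S" "adj q p" using p by (auto simp: parents_def)
      ultimately show "q \<in> S" using loc[of q p] by blast
    qed
  qed
qed

text \<open>Indices are levels, so the sequence starts at 1 and \<open>\<sigma> 0\<close> is
  arbitrary.\<close>

definition geodesic :: "nat \<Rightarrow> (nat \<Rightarrow> 'v set) \<Rightarrow> bool" where
  "geodesic N \<sigma> \<longleftrightarrow> (\<forall>k. 1 \<le> k \<and> k \<le> N \<longrightarrow> clique (\<sigma> k) \<and> (\<forall>x\<in>\<sigma> k. lev x = k)) \<and>
     (\<forall>k. 1 \<le> k \<and> k < N \<longrightarrow> \<sigma> k = parents k (\<sigma> (Suc k)))"

lemma geodesic_exists:
  assumes "v \<in> V"
  obtains \<sigma> where "geodesic (lev v) \<sigma>"
proof -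
  define N where "N = lev v"
  \<comment> \<open>\<open>f i\<close> is the \<open>i\<close>-th projection of \<open>v\<close>, on
    level \<open>N - i\<close>; the geodesic is this sequence read backwards.\<close>
  define f where "f = rec_nat {v} (\<lambda>i. parents (N - Suc i))"
  have f0: "f 0 = {v}" and fS: "f (Suc i) = parents (N - Suc i) (f i)" for i by (simp_all add: f_def)
  have f: "clique (f i) \<and> (\<forall>x\<in>f i. lev x = N - i)" if "i < N" for i
    using that
  proof (induction i)
    case 0
    then show ?case using assms by (simp add: f0 clique_def N_def)
  next
    case (Suc i)
    then have "N - i = Suc (N - Suc i)" by simp
    then show ?case using Suc parents_clique_set[of "f i" "N - Suc i"] by (simp add: fS) (simp add: parents_def)
  qed
  have "geodesic N (\<lambda>k. f (N - k))"
    unfolding geodesic_def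
  proof (intro conjI allI impI)
    fix k assume k: "1 \<le> k \<and> k < N"
    then have "N - k = Suc (N - Suc k)" using Suc_diff_Suc[of k N] by simp
    moreover have "N - Suc (N - Suc k) = k" using k by simp
    ultimately show "f (N - k) = parents k (f (N - Suc k))" using fS[of "N - Suc k"] by simp
  next
    fix k assume "1 \<le> k \<and> k \<le> N"
    then show "clique (f (N - k))" "\<forall>x\<in>f (N - k). lev x = k" using f[of "N - k"] by auto
  qed
  then show ?thesis using that by (simp add: N_def)
qed

text \<open>A vertex near \<open>\<sigma> k\<close> has level at most \<open>Suc k\<close>, and one
  near level \<open>Suc (Suc k)\<close> has at least that level. So it is a common parent of the
  last simplex.\<close>

lemma geodesic_directed:
  assumes "geodesic N \<sigma>" "1 \<le> k" "Suc (Suc k) \<le> N"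
  shows "directed (\<sigma> k) (\<sigma> (Suc k)) (\<sigma> (Suc (Suc k)))"
proof -
  have c: "clique (\<sigma> m)" "\<And>x. x \<in> \<sigma> m \<Longrightarrow> lev x = m" if "1 \<le> m" "m \<le> N" for m
    using assms(1) that by (auto simp: geodesic_def)
  have p: "\<sigma> (Suc k) = parents (Suc k) (\<sigma> (Suc (Suc k)))"
    using assms by (auto simp: geodesic_def)
  have "w \<in> \<sigma> (Suc k)"
    if w: "\<forall>t\<in>\<sigma> (Suc (Suc k)). w = t \<or> adj w t" "q \<in> \<sigma> k" "w = q \<or> adj w q" for w q
  proof -
    have "lev q = k" using c(2)[of k q] w assms by simp
    then have le: "lev w \<le> Suc k" using w(3) adj_lev[OF adj_sym] by auto
    obtain t where t: "t \<in> \<sigma> (Suc (Suc k))" using c(1)[of "Suc (Suc k)"] assms by (auto simp: clique_def)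
    have lt: "lev t = Suc (Suc k)" if "t \<in> \<sigma> (Suc (Suc k))" for t
      using c(2)[of "Suc (Suc k)" t] that assms by simp
    have "adj w t" if "t \<in> \<sigma> (Suc (Suc k))" for t using w(1) le lt[OF that] that by auto
    moreover from this have "lev w = Suc k" using adj_lev[of w t] lt[OF t] t le by simp
    ultimately show ?thesis unfolding p by (auto simp: parents_def intro: adj_sym)
  qed
  moreover have "adj s t" if "s \<in> \<sigma> (Suc k)" "t \<in> \<sigma> (Suc (Suc k))" for s t
    using that adj_sym unfolding p by (auto simp: parents_def)
  ultimately show ?thesis using c(1)[of "Suc (Suc k)"] assms unfolding directed_def by auto
qed

lemma directed_image:
  assumes a: "bij_betw a V V" "\<And>x y. x \<in> V \<Longrightarrow> y \<in> V \<Longrightarrow> adj (a x) (a y) \<longleftrightarrow> adj x y"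
    and sub: "P \<subseteq> V" "S \<subseteq> V" and d: "directed P S T"
  shows "directed (a ` P) (a ` S) (a ` T)"
proof -
  have T: "clique T" using d by (simp add: directed_def)
  then have TV: "T \<subseteq> V" by (simp add: clique_def)
  have inj: "a x = a y \<longleftrightarrow> x = y" if "x \<in> V" "y \<in> V" for x y
    using a(1) that by (auto simp: bij_betw_def inj_on_def)
  have aV: "a x \<in> V" if "x \<in> V" for x using a(1) that by (auto simp: bij_betw_def)
  have c: "clique (a ` T)"
    using T TV aV a(2) unfolding clique_def by (auto simp: subset_iff)
  have e: "adj (a s) (a t)" if "s \<in> S" "t \<in> T" for s t
  proof -
    have "adj s t" using d that unfolding directed_def by (elim conjE) simp
    then show ?thesis using a(2)[of s t] adj_V[of s t] adj_V[of t s] adj_sym[of s t] by simp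
  qed
  have l: "w \<in> a ` S"
    if w: "\<forall>t\<in>a ` T. w = t \<or> adj w t" "p \<in> a ` P" "w = p \<or> adj w p" for w p
  proof -
    have "w \<in> V" using w sub aV adj_V by blast
    then obtain u where u: "u \<in> V" "w = a u" using a(1) by (auto simp: bij_betw_def)
    obtain q where q: "q \<in> P" "p = a q" using w(2) by blast
    have "u = t \<or> adj u t" if "t \<in> T" for t
      using w(1) that u TV inj[of u t] a(2)[of u t] by auto
    moreover have "u = q \<or> adj u q" using w(3) u q sub(1) inj[of u q] a(2)[of u q] by auto
    moreover have "\<forall>w. (\<forall>t\<in>T. w = t \<or> adj w t) \<and> (\<exists>p\<in>P. w = p \<or> adj w p) \<longrightarrow> w \<in> S"
      using d unfolding directed_def by (elim conjE)
    ultimately have "u \<in> S" using q(1) by blast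
    then show ?thesis using u by blast
  qed
  show ?thesis
    unfolding directed_def
  proof (intro conjI allI impI)
    fix w assume "(\<forall>t\<in>a ` T. w = t \<or> adj w t) \<and> (\<exists>p\<in>a ` P. w = p \<or> adj w p)"
    then show "w \<in> a ` S" using l[of w] by blast
  qed (use c e in auto)
qed

text \<open>A geodesic whose consecutive pairs of simplices at \<open>i\<close> and \<open>j\<close> differ by an automorphism is
  continued periodically; being a directed geodesic is a local condition, so the levels keep
  growing along the continuation.\<close>
lemma periodic_geodesic_escapes:
  assumes a: "bij_betw a V V" "\<And>x y. x \<in> V \<Longrightarrow> y \<in> V \<Longrightarrow> adj (a x) (a y) \<longleftrightarrow> adj x y"
    and g: "geodesic N \<sigma>" and ij: "1 \<le> i" "i < j" "j < N"
    and shift: "a ` \<sigma> i = \<sigma> j" "a ` \<sigma> (Suc i) = \<sigma> (Suc j)" and m: "0 < m"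
  shows "\<exists>x\<in>V. (a ^^ m) x \<noteq> x"
proof -
  define L where "L = j - i"
  \<comment> \<open>The recursion goes back by \<open>L\<close>; it is unrolled to depth
    \<open>r\<close>, and \<open>f r k\<close> has its final value as soon as
    \<open>k \<le> r\<close>.\<close>
  define f where "f = rec_nat \<sigma> (\<lambda>_ \<tau> k. if k \<le> Suc j then \<sigma> k else a ` \<tau> (k - L))"
  define \<tau> where "\<tau> k = f k k" for k
  have f0: "f 0 = \<sigma>" and fS: "f (Suc r) k = (if k \<le> Suc j then \<sigma> k else a ` f r (k - L))" for r k
    by (simp_all add: f_def)
  have stable: "f r k = f k k" if "k \<le> r" for r k
    using that
  proof (induction k arbitrary: r rule: less_induct)
    case (less k)
    show ?case
    proof (cases "k \<le> Suc j")
      case True then show ?thesis by (cases r; cases k) (auto simp: fS f0)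
    next
      case False
      then obtain r' k' where rk: "r = Suc r'" "k = Suc k'" using less.prems by (cases r; cases k) auto
      have "k - L < k" "k - L \<le> r'" "k - L \<le> k'" using ij False rk less.prems by (auto simp: L_def)
      then show ?thesis using less.IH[of "k - L" r'] less.IH[of "k - L" k'] False rk by (simp add: fS)
    qed
  qed
  have small: "\<tau> k = \<sigma> k" if "k \<le> Suc j" for k
    using that by (cases k) (auto simp: \<tau>_def fS f0)
  have big: "\<tau> (k + L) = a ` \<tau> k" if ik: "i \<le> k" for k
  proof -
    have jL: "j = i + L" "0 < L" using ij by (auto simp: L_def)
    \<comment> \<open>At \<open>i\<close> and \<open>Suc i\<close> the translate overlaps the given
      geodesic, and \<open>shift\<close> says that they agree there; afterwards the recursion
      applies.\<close>
    consider "k = i" | "k = Suc i" | "Suc i < k" using ik by linarith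
    then show ?thesis
    proof cases
      case 1 then show ?thesis using small[of i] small[of j] shift jL by simp
    next
      case 2 then show ?thesis using small[of "Suc i"] small[of "Suc j"] shift jL by simp
    next
      case 3
      obtain r where r: "k + L = Suc r" using 3 by (cases "k + L") auto
      have "Suc r - L = k" using r by simp
      then have "\<tau> (k + L) = a ` f r k" using 3 jL r by (simp add: \<tau>_def fS)
      also have "f r k = \<tau> k" using stable[of k r] r jL unfolding \<tau>_def by simp
      finally show ?thesis .
    qed
  qed
  have jL: "j = i + L" "0 < L" using ij by (auto simp: L_def)
  have aV: "a ` S \<subseteq> V" if "S \<subseteq> V" for S using a(1) that by (auto simp: bij_betw_def)
  have \<sigma>V: "\<sigma> k \<subseteq> V" if "1 \<le> k" "k \<le> N" for k using g that by (auto simp: geodesic_def clique_def)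
  have sub: "\<tau> k \<subseteq> V" if "1 \<le> k" for k
    using that
  proof (induction k rule: less_induct)
    case (less k)
    show ?case
    proof (cases "k \<le> Suc j")
      case True then show ?thesis using small \<sigma>V[of k] less.prems ij by simp
    next
      case False
      then have "\<tau> (k - L) \<subseteq> V" using less.IH[of "k - L"] jL by simp
      then show ?thesis using big[of "k - L"] aV False jL by simp
    qed
  qed
  have dir: "directed (\<tau> k) (\<tau> (Suc k)) (\<tau> (Suc (Suc k)))" if "1 \<le> k" for k
    using that
  proof (induction k rule: less_induct)
    case (less k)
    show ?case
    \<comment> \<open>A triple that leaves the given segment starts at \<open>j\<close> or later, so
      it is a translate of the triple \<open>L\<close> steps earlier, which starts at
      \<open>i\<close> or later.\<close>
    proof (cases "Suc (Suc k) \<le> Suc j")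
      case True
      then show ?thesis using small[of k] small[of "Suc k"] small[of "Suc (Suc k)"]
          geodesic_directed[OF g, of k] less.prems ij by simp
    next
      case False
      define l where "l = k - L"
      have l: "k = l + L" "i \<le> l" "1 \<le> l" "l < k" using False jL ij by (auto simp: l_def)
      then have "directed (\<tau> l) (\<tau> (Suc l)) (\<tau> (Suc (Suc l)))" using less.IH by blast
      then have "directed (a ` \<tau> l) (a ` \<tau> (Suc l)) (a ` \<tau> (Suc (Suc l)))"
        using directed_image[OF a] sub l by simp
      then show ?thesis using big[of l] big[of "Suc l"] big[of "Suc (Suc l)"] l by simp
    qed
  qed
  have lev: "clique (\<tau> (Suc k)) \<and> (\<forall>x\<in>\<tau> (Suc k). lev x = Suc k) \<and> \<tau> k = parents k (\<tau> (Suc k))"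
    if "1 \<le> k" for k
    using that
  proof (induction k rule: dec_induct)
    case base
    have N: "Suc 1 \<le> N" "1 < N" using ij by simp_all
    have "\<sigma> 1 = parents 1 (\<sigma> (Suc 1))" using g N unfolding geodesic_def by blast
    moreover have "clique (\<sigma> (Suc 1))" "\<forall>x\<in>\<sigma> (Suc 1). lev x = Suc 1"
      using g N le_SucI[OF order_refl, of 1] unfolding geodesic_def by blast+
    ultimately show ?case using small[of 1] small[of "Suc 1"] ij by simp
  next
    case (step k)
    then have d: "directed (parents k (\<tau> (Suc k))) (\<tau> (Suc k)) (\<tau> (Suc (Suc k)))"
      using dir[of k] by simp
    have "clique (\<tau> (Suc k))" "\<forall>x\<in>\<tau> (Suc k). lev x = Suc k" using step.IH by simp_all
    note next_level = directed_step[OF this step.hyps(1) d]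
    have "clique (\<tau> (Suc (Suc k)))" using d unfolding directed_def by (rule conjunct1)
    then show ?case by (intro conjI next_level)
  qed
  have iter: "\<tau> (i + r * L) = (a ^^ r) ` \<tau> i" for r
  proof (induction r)
    case (Suc r)
    have "\<tau> (i + r * L + L) = a ` \<tau> (i + r * L)" by (rule big) simp
    then show ?case using Suc by (simp add: algebra_simps image_comp)
  qed simp
  have levels: "lev x = k" if xk: "x \<in> \<tau> k" "1 \<le> k" for x k
  proof (cases "k = 1")
    case True
    then show ?thesis using xk lev[of 1] by (simp add: parents_def)
  next
    case False
    then obtain l where "k = Suc l" "1 \<le> l" using xk(2) by (cases k) auto
    then show ?thesis using lev[of l] xk by simp
  qed
  have "\<tau> i \<noteq> {}" using small[of i] g ij by (auto simp: geodesic_def clique_def)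
  then obtain x where x: "x \<in> \<tau> i" by blast
  \<comment> \<open>\<open>a\<close> need not preserve levels on the whole graph; along the
    continuation it raises them by \<open>L\<close>.\<close>
  then have "lev x = i" "lev ((a ^^ m) x) = i + m * L"
    using levels[of x i] levels[of "(a ^^ m) x" "i + m * L"] iter[of m] ij by auto
  moreover have "m * L \<noteq> 0" using m jL by simp
  ultimately have "(a ^^ m) x \<noteq> x" by (metis add_cancel_left_right)
  moreover have "x \<in> V" using x sub ij by blast
  ultimately show ?thesis by blast
qed

text \<open>By induction every level is finite: a vertex above level 1 has a neighbour one level
  lower, and degrees are finite.\<close>

lemma unbounded_levels:
  assumes "infinite V" "finite {x \<in> V. lev x = 1}"
  shows "\<exists>v\<in>V. N < lev v"
proof (rule ccontr)
  assume "\<not> (\<exists>v\<in>V. N < lev v)"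
  then have "V \<subseteq> (\<Union>n\<le>N. {x \<in> V. lev x = n})" by (auto simp: not_less)
  moreover have "finite {x \<in> V. lev x = n}" for n
  proof (induction n)
    case 0
    have "{x \<in> V. lev x = 0} = {}" using lev_pos by fastforce
    then show ?case by (metis finite.emptyI)
  next
    case (Suc n)
    show ?case
    proof (cases "n = 0")
      case False
      have "{x \<in> V. lev x = Suc n} \<subseteq> (\<Union>p\<in>{p \<in> V. lev p = n}. {y. adj p y})"
      proof
        fix x assume "x \<in> {x \<in> V. lev x = Suc n}"
        then obtain p where p: "lev p = n" "adj x p"
          using clique_common_parent[of "{x}" n] False by auto
        then show "x \<in> (\<Union>p\<in>{p \<in> V. lev p = n}. {y. adj p y})"
          using adj_sym[OF p(2)] adj_V[OF adj_sym[OF p(2)]] by (intro UN_I[of p]) simp_all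
      qed
      then show ?thesis using Suc locally_finite by (meson finite_UN_I finite_subset)
    qed (use assms in simp)
  qed
  ultimately have "finite V" by (meson finite_UN_I finite_atMost finite_subset)
  then show False using assms by blast
qed

end

section \<open>Proper cocompact actions\<close>

lemma affine_extension_inj:
  assumes "inj_on f W" "{v. t v \<noteq> 0} \<subseteq> W" "v \<in> W"
  shows "affine_extension f t (f v) = t v"
proof (cases "t v = 0")
  case True
  then have "{u. t u \<noteq> 0 \<and> f u = f v} = {}" using assms by (auto simp: inj_on_def)
  then have "affine_extension f t (f v) = sum t {}"
    unfolding affine_extension_def by (rule arg_cong)
  then show ?thesis using True by simp
next
  case False
  then have "{u. t u \<noteq> 0 \<and> f u = f v} = {v}" using assms by (auto simp: inj_on_def)
  then show ?thesis by (simp add: affine_extension_def)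
qed

lemma affine_extension_vertex_point: "affine_extension f (vertex_point v) = vertex_point (f v)"
proof
  fix w
  have "{u. vertex_point v u \<noteq> 0 \<and> f u = w} = (if f v = w then {v} else {})"
    by (auto simp: vertex_point_def)
  then show "affine_extension f (vertex_point v) w = vertex_point (f v) w"
    by (auto simp: affine_extension_def vertex_point_def)
qed

text \<open>Barycentres represent simplices by points: they determine the simplex, and a closed
  simplex contains only those of its faces.\<close>

definition barycenter :: "'v set \<Rightarrow> 'v \<Rightarrow> real" where
  "barycenter s = (\<lambda>v. if v \<in> s then 1 / card s else 0)"

lemma barycenter_mem: "finite s \<Longrightarrow> s \<noteq> {} \<Longrightarrow> barycenter s \<in> geometric_simplex s"
  by (auto simp: geometric_simplex_def barycenter_def)

lemma barycenter_support: "finite s \<Longrightarrow> {v. barycenter s v \<noteq> 0} = s"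
  by (auto simp: barycenter_def)

text \<open>Every subset of \<open>D\<close> is closed in the CW topology, so the sets
  \<open>U d\<close> are open. Each contains a single point of \<open>D\<close>, and finitely many
  of them cover \<open>K\<close>.\<close>

lemma compactin_finite_discrete:
  assumes X: "simplicial_complex X" and K: "compactin (geometric_realization X) K"
    and D: "D \<subseteq> topspace (geometric_realization X)" "\<And>s. s \<in> X \<Longrightarrow> finite (D \<inter> geometric_simplex s)"
  shows "finite (D \<inter> K)"
proof -
  let ?R = "geometric_realization X"
  define U where "U d = topspace ?R - (D - {d})" for d
  have open_U: "openin ?R (U d)" for d
    unfolding openin_geometric_realization
  proof (intro conjI ballI)
    show "U d \<subseteq> (\<Union>s\<in>X. geometric_simplex s)" by (auto simp: U_def topspace_geometric_realization)
    fix s assume s: "s \<in> X"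
    have "U d \<inter> geometric_simplex s = geometric_simplex s - (D \<inter> geometric_simplex s - {d})"
      using s by (auto simp: U_def topspace_geometric_realization)
    moreover have "closed (D \<inter> geometric_simplex s - {d})"
      using D(2)[OF s] by (intro finite_imp_closed) auto
    ultimately show "openin (top_of_set (geometric_simplex s)) (U d \<inter> geometric_simplex s)"
      by (metis Diff_eq open_Compl openin_open_Int)
  qed
  show ?thesis
  proof (cases "D \<inter> K = {}")
    case False
    have KR: "K \<subseteq> topspace ?R" using K by (rule compactin_subset_topspace)
    have "K \<subseteq> \<Union>(U ` (D \<inter> K))"
      using False KR by (auto simp: U_def)
    then obtain F where F: "finite F" "F \<subseteq> U ` (D \<inter> K)" "K \<subseteq> \<Union>F"
      using K open_U unfolding compactin_def by (metis (no_types, lifting) imageE)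
    obtain E where E: "finite E" "E \<subseteq> D \<inter> K" "F = U ` E"
      using F(1,2) by (meson finite_subset_image)
    have "D \<inter> K \<subseteq> E"
    proof
      fix d assume d: "d \<in> D \<inter> K"
      then obtain e where "e \<in> E" "d \<in> U e" using F(3) unfolding E(3) by blast
      then show "d \<in> E" using d by (auto simp: U_def)
    qed
    then show ?thesis using E(1) finite_subset by blast
  qed simp
qed

locale geometric_action =
  fixes G :: "('g, 'm) monoid_scheme" and X :: "'v set set" and \<phi> :: "'g \<Rightarrow> 'v \<Rightarrow> 'v"
  assumes X: "simplicial_complex X"
    and action: "simplicial_action G X \<phi>"
    and proper: "proper_action G (geometric_realization X) (\<lambda>g. affine_extension (\<phi> g))"
    and cocompact: "cocompact_action G (geometric_realization X) (\<lambda>g. affine_extension (\<phi> g))"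
begin

sublocale group_action G "\<Union>X" \<phi>
  using action by (simp add: simplicial_action_def)

lemma simplex_finite: "s \<in> X \<Longrightarrow> finite s \<and> s \<noteq> {}"
  using X by (simp add: simplicial_complex_def)

lemma bij: "g \<in> carrier G \<Longrightarrow> bij_betw (\<phi> g) (\<Union>X) (\<Union>X)"
  using action by (simp add: simplicial_action_def simplicial_automorphism_def)

lemma inj: "g \<in> carrier G \<Longrightarrow> inj_on (\<phi> g) (\<Union>X)"
  using bij by (auto simp: bij_betw_def)

lemma simplex_image: "g \<in> carrier G \<Longrightarrow> s \<in> X \<Longrightarrow> \<phi> g ` s \<in> X"
  using action unfolding simplicial_action_def simplicial_automorphism_def by blast

lemma simplex_image_iff:
  assumes "g \<in> carrier G" "s \<subseteq> \<Union>X" shows "\<phi> g ` s \<in> X \<longleftrightarrow> s \<in> X"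
proof
  assume "\<phi> g ` s \<in> X"
  then obtain t where t: "t \<in> X" "\<phi> g ` s = \<phi> g ` t"
    using action assms(1) unfolding simplicial_action_def simplicial_automorphism_def by blast
  then have "s = t" using inj_on_image_eq_iff[OF inj[OF assms(1)] assms(2), of t] by blast
  then show "s \<in> X" using t by simp
qed (rule simplex_image[OF assms(1)])

lemma vertex_point_topspace: "v \<in> \<Union>X \<Longrightarrow> vertex_point v \<in> topspace (geometric_realization X)"
  using vertex_point_mem[of _ v] simplex_finite by (auto simp: topspace_geometric_realization)

lemma barycenter_topspace:
  assumes "s \<in> X" shows "barycenter s \<in> topspace (geometric_realization X)"
  unfolding topspace_geometric_realization
  using barycenter_mem[of s] simplex_finite[OF assms] assms by (intro UN_I[of s]) simp_all

lemma finite_transporter: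
  assumes "a \<in> \<Union>X" "b \<in> \<Union>X"
  shows "finite {g \<in> carrier G. \<phi> g a = b}"
proof -
  let ?K = "{vertex_point a, vertex_point b}"
  have "compactin (geometric_realization X) ?K"
    using assms vertex_point_topspace by (intro finite_imp_compactin) auto
  then have "finite {g \<in> carrier G. affine_extension (\<phi> g) ` ?K \<inter> ?K \<noteq> {}}"
    using proper unfolding proper_action_def by (elim allE impE)
  moreover have "{g \<in> carrier G. \<phi> g a = b} \<subseteq> {g \<in> carrier G. affine_extension (\<phi> g) ` ?K \<inter> ?K \<noteq> {}}"
    by (auto simp: affine_extension_vertex_point)
  ultimately show ?thesis by (rule rev_finite_subset)
qed

text \<open>The barycentre of any simplex is the translate of a point of the compact set
  \<open>K\<close>, that point is itself a barycentre, and \<open>K\<close> contains only finitely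
  many of those.\<close>

lemma finitely_many_simplex_orbits:
  "\<exists>F. finite F \<and> F \<subseteq> X \<and> (\<forall>s\<in>X. \<exists>g\<in>carrier G. \<exists>t\<in>F. s = \<phi> g ` t)"
proof -
  let ?R = "geometric_realization X"
  obtain K where K: "compactin ?R K" "topspace ?R = (\<Union>g\<in>carrier G. affine_extension (\<phi> g) ` K)"
    using cocompact by (auto simp: cocompact_action_def)
  define F where "F = {s \<in> X. barycenter s \<in> K}"
  have inj_b: "inj_on barycenter X"
    by (rule inj_onI) (metis barycenter_support simplex_finite)
  have "finite (barycenter ` X \<inter> K)"
  proof (rule compactin_finite_discrete[OF X K(1)])
    show "barycenter ` X \<subseteq> topspace ?R"
      using barycenter_topspace by (rule image_subsetI)
    fix s assume s: "s \<in> X"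
    have "barycenter ` X \<inter> geometric_simplex s \<subseteq> barycenter ` Pow s"
    proof
      fix p assume "p \<in> barycenter ` X \<inter> geometric_simplex s"
      then obtain t where t: "t \<in> X" "p = barycenter t" "p \<in> geometric_simplex s" by blast
      then have "t \<subseteq> s"
        using barycenter_support[of t] simplex_finite[of t] by (auto simp: geometric_simplex_def)
      then show "p \<in> barycenter ` Pow s" using t by blast
    qed
    then show "finite (barycenter ` X \<inter> geometric_simplex s)"
      using simplex_finite[OF s] by (meson finite_Pow_iff finite_imageI finite_subset)
  qed
  moreover have "barycenter ` F \<subseteq> barycenter ` X \<inter> K" by (auto simp: F_def)
  ultimately have "finite (barycenter ` F)" by (rule rev_finite_subset)
  moreover have "inj_on barycenter F" using inj_b by (rule inj_on_subset) (auto simp: F_def)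
  ultimately have "finite F" by (rule finite_imageD)
  moreover have "\<exists>g\<in>carrier G. \<exists>t\<in>F. s = \<phi> g ` t" if s: "s \<in> X" for s
  proof -
    have "barycenter s \<in> topspace ?R" by (rule barycenter_topspace[OF s])
    then obtain g p where g: "g \<in> carrier G" "p \<in> K" "barycenter s = affine_extension (\<phi> g) p"
      using K(2) by auto
    have "p \<in> topspace ?R" using compactin_subset_topspace[OF K(1)] g(2) by blast
    then have supp: "{v. p v \<noteq> 0} \<subseteq> \<Union>X"
      by (auto simp: topspace_geometric_realization geometric_simplex_def)
    define t where "t = {v \<in> \<Union>X. \<phi> g v \<in> s}"
    have "s \<subseteq> \<phi> g ` \<Union>X" using bij[OF g(1)] s by (auto simp: bij_betw_def)
    have st: "s = \<phi> g ` t"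
    proof
      show "s \<subseteq> \<phi> g ` t"
      proof
        fix w assume w: "w \<in> s"
        then obtain v where "v \<in> \<Union>X" "w = \<phi> g v" using \<open>s \<subseteq> \<phi> g ` \<Union>X\<close> by (meson imageE subsetD)
        then show "w \<in> \<phi> g ` t" using w by (simp add: t_def)
      qed
      show "\<phi> g ` t \<subseteq> s" by (rule image_subsetI) (simp add: t_def)
    qed
    have "t \<subseteq> \<Union>X" unfolding t_def by (rule Collect_restrict)
    then have tX: "t \<in> X" using simplex_image_iff[OF g(1), of t] s st by simp
    have "card t = card s"
      unfolding st by (rule card_image[OF inj_on_subset[OF inj[OF g(1)] \<open>t \<subseteq> \<Union>X\<close>], symmetric])
    \<comment> \<open>The vertex map is injective, so coordinates can be read off before or after
      the translation.\<close>
    have "p v = barycenter t v" for v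
    proof (cases "v \<in> \<Union>X")
      case True
      then have "p v = barycenter s (\<phi> g v)"
        using affine_extension_inj[OF inj[OF g(1)] supp] g(3) by simp
      then show ?thesis using True \<open>card t = card s\<close> by (simp add: barycenter_def t_def)
    next
      case False
      then have "p v = 0" using supp by blast
      then show ?thesis using False by (simp add: barycenter_def t_def)
    qed
    then have "p = barycenter t" by (rule ext)
    then have "t \<in> F" using tX g(2) by (simp add: F_def)
    then show ?thesis using g(1) st by blast
  qed
  moreover have "F \<subseteq> X" by (auto simp: F_def)
  ultimately show ?thesis by (intro exI[of _ F] conjI ballI)
qed

text \<open>An edge at \<open>x\<close> is a translate of one of finitely many simplices, by an
  element that takes one of its vertices to \<open>x\<close>; properness leaves finitely many such
  elements.\<close>

lemma finite_neighbors: "finite {y. edge_rel X x y}"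
proof (cases "x \<in> \<Union>X")
  case x: True
  obtain F where F: "finite F" "F \<subseteq> X" "\<And>s. s \<in> X \<Longrightarrow> \<exists>g\<in>carrier G. \<exists>t\<in>F. s = \<phi> g ` t"
    using finitely_many_simplex_orbits by (elim exE conjE) (simp add: that)
  have "{y. edge_rel X x y} \<subseteq> (\<Union>t\<in>F. \<Union>a\<in>t. \<Union>g\<in>{g \<in> carrier G. \<phi> g a = x}. \<phi> g ` t)"
  proof
    fix y assume "y \<in> {y. edge_rel X x y}"
    then have "{x, y} \<in> X" by (simp add: edge_rel_def)
    then obtain g t where g: "g \<in> carrier G" "t \<in> F" "{x, y} = \<phi> g ` t" using F(3) by blast
    then obtain a where "a \<in> t" "\<phi> g a = x" by (metis imageE insertI1)
    moreover have "y \<in> \<phi> g ` t" using g(3) by blast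
    ultimately show "y \<in> (\<Union>t\<in>F. \<Union>a\<in>t. \<Union>g\<in>{g \<in> carrier G. \<phi> g a = x}. \<phi> g ` t)"
      using g by blast
  qed
  moreover have "finite (\<Union>t\<in>F. \<Union>a\<in>t. \<Union>g\<in>{g \<in> carrier G. \<phi> g a = x}. \<phi> g ` t)"
    using F(1,2) simplex_finite x by (intro finite_UN_I finite_transporter finite_imageI) auto
  ultimately show ?thesis by (rule finite_subset)
next
  case False
  then have "{y. edge_rel X x y} = {}" by (auto simp: edge_rel_def)
  then show ?thesis by simp
qed

lemma finite_vertex_representatives:
  "\<exists>F. finite F \<and> F \<subseteq> \<Union>X \<and> (\<forall>v\<in>\<Union>X. \<exists>g\<in>carrier G. \<exists>u\<in>F. v = \<phi> g u)"
proof -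
  obtain F where F: "finite F" "F \<subseteq> X" "\<And>s. s \<in> X \<Longrightarrow> \<exists>g\<in>carrier G. \<exists>t\<in>F. s = \<phi> g ` t"
    using finitely_many_simplex_orbits by (elim exE conjE) (simp add: that)
  have "\<exists>g\<in>carrier G. \<exists>u\<in>\<Union>F. v = \<phi> g u" if "v \<in> \<Union>X" for v
  proof -
    obtain s where "s \<in> X" "v \<in> s" using \<open>v \<in> \<Union>X\<close> by blast
    then show ?thesis using F(3)[of s] by blast
  qed
  moreover have "finite (\<Union>F)" using F simplex_finite by blast
  moreover have "\<Union>F \<subseteq> \<Union>X" using F(2) by blast
  ultimately show ?thesis by (intro exI[of _ "\<Union>F"] conjI ballI)
qed

lemma infinite_vertices:
  assumes "infinite (carrier G)" "X \<noteq> {}"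
  shows "infinite (\<Union>X)"
proof
  assume fin: "finite (\<Union>X)"
  obtain s where s: "s \<in> X" using assms(2) by auto
  then obtain v where "v \<in> s" using simplex_finite[OF s] by auto
  then have v: "v \<in> \<Union>X" using s by auto
  have "carrier G \<subseteq> (\<Union>w\<in>\<Union>X. {g \<in> carrier G. \<phi> g v = w})"
    using element_image v by blast
  then show False using fin finite_transporter[OF v] assms(1) by (meson finite_UN_I finite_subset)
qed

lemma edge_rel_image:
  assumes "g \<in> carrier G" "x \<in> \<Union>X" "y \<in> \<Union>X"
  shows "edge_rel X (\<phi> g x) (\<phi> g y) \<longleftrightarrow> edge_rel X x y"
proof -
  have "\<phi> g x = \<phi> g y \<longleftrightarrow> x = y" using inj_on_eq_iff[OF inj[OF assms(1)] assms(2,3)] .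
  moreover have "{\<phi> g x, \<phi> g y} \<in> X \<longleftrightarrow> {x, y} \<in> X"
    using simplex_image_iff[OF assms(1), of "{x, y}"] assms(2,3) by simp
  ultimately show ?thesis by (simp add: edge_rel_def)
qed

lemma action_pow:
  assumes "g \<in> carrier G" "x \<in> \<Union>X"
  shows "\<phi> (g [^]\<^bsub>G\<^esub> (n::nat)) x = (\<phi> g ^^ n) x"
proof (induction n)
  case 0
  have "\<phi> \<one>\<^bsub>G\<^esub> x = x" using id_eq_one assms(2) by (metis restrict_apply')
  then show ?case by simp
next
  case (Suc n)
  interpret group G using group_hom group_hom.axioms(1) by blast
  have "g [^]\<^bsub>G\<^esub> Suc n = g \<otimes>\<^bsub>G\<^esub> g [^]\<^bsub>G\<^esub> n" using nat_pow_Suc2[OF assms(1)] by simp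
  then show ?case using Suc composition_rule[of x g "g [^]\<^bsub>G\<^esub> n"] assms by simp
qed

end

section \<open>Systolic complexes and groups\<close>

locale systolic_complex =
  fixes X :: "'v set set"
  assumes systolic: "systolic X"
begin

lemma complex: "simplicial_complex X" using systolic by (simp add: k_systolic_def)

sublocale locally_six_large "edge_rel X" "triangle_rel X"
  using systolic by (intro systolic_locally_six_large) (simp_all add: k_systolic_def)

definition root :: 'v where "root = (SOME v. v \<in> \<Union>X)"

lemma root: "root \<in> \<Union>X"
proof -
  obtain s where "s \<in> X" using systolic by (auto simp: k_systolic_def)
  moreover from this have "s \<noteq> {}" using complex by (simp add: simplicial_complex_def)
  ultimately have "\<exists>v. v \<in> \<Union>X" by auto
  then show ?thesis unfolding root_def by (rule someI_ex)
qed

sublocale cover: total_cover "edge_rel X" "triangle_rel X" root "cover_vertices root" "cover_adj root"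
  by (rule total_cover)

lemma edge_vertices: "edge_rel X x y \<Longrightarrow> x \<in> \<Union>X \<and> y \<in> \<Union>X"
  by (auto simp: edge_rel_def)

sublocale proj: simplicial_covering X "cover_vertices root" "cover_adj root" hd
proof
  show "simplicial_complex X" by (rule complex)
  show "cover_adj root e f \<Longrightarrow> e \<in> cover_vertices root" for e f by (rule cover.A_mem)
  show "cover_adj root e f \<Longrightarrow> cover_adj root f e" for e f by (rule cover.A_sym)
  show "cover_adj root e f \<Longrightarrow> {hd e, hd f} \<in> X \<and> hd e \<noteq> hd f" for e f
    using cover.A_adj[of e f] by (simp add: edge_rel_def)
  show "\<lbrakk>cover_adj root e f; cover_adj root e f'; hd f = hd f'\<rbrakk> \<Longrightarrow> f = f'" for e f f'
    by (rule cover.lift_unique)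
  show "\<lbrakk>e \<in> cover_vertices root; {hd e, x} \<in> X; hd e \<noteq> x\<rbrakk> \<Longrightarrow> \<exists>f. cover_adj root e f \<and> hd f = x" for e x
    using cover.lift_exists[of e x] by (simp add: edge_rel_def)
  show "cover_adj root f f'"
    if "cover_adj root e f" "cover_adj root e f'" "f \<noteq> f'" "{hd e, hd f, hd f'} \<in> X" for e f f'
  proof -
    have "hd f \<noteq> hd f'" using cover.lift_unique[OF that(1,2)] that(3) by blast
    moreover have "hd e \<noteq> hd f" "hd e \<noteq> hd f'"
      using cover.A_adj[OF that(1)] cover.A_adj[OF that(2)] by (simp_all add: edge_rel_def)
    ultimately show ?thesis using cover.lift_tri[OF that(1,2)] that(4) by (simp add: triangle_rel_def)
  qed
qed

lemma path_from_root:
  assumes "e \<in> cover_vertices root"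
  shows "\<exists>n p. p 0 = [root] \<and> p n = e \<and> (\<forall>i<n. cover_adj root (p i) (p (Suc i)))"
  using assms
proof (induction "length e" arbitrary: e rule: less_induct)
  case less
  show ?case
  proof (cases "length e = 1")
    case True
    then have "e = [root]" using cover.level_one less.prems by blast
    then show ?thesis by (intro exI[of _ 0] exI[of _ "\<lambda>_. e"]) simp
  next
    case False
    then have "1 < length e" using cover.level_pos[OF less.prems] by simp
    then obtain f where f: "cover_adj root e f" "length e = Suc (length f)"
      using cover.parent_exists less.prems by blast
    then obtain n p where p: "p 0 = [root]" "p n = f" "\<forall>i<n. cover_adj root (p i) (p (Suc i))"
      using less.hyps[of f] cover.A_mem2 by auto
    have "\<forall>i<Suc n. cover_adj root ((p(Suc n := e)) i) ((p(Suc n := e)) (Suc i))"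
      using p cover.A_sym[OF f(1)] by (auto simp: less_Suc_eq)
    then show ?thesis using p(1) by (intro exI[of _ "Suc n"] exI[of _ "p(Suc n := e)"]) simp
  qed
qed

text \<open>Two cover vertices over the same point are connected by a path through the root. Its
  projection is closed, so by simple connectivity the path is closed as well.\<close>

lemma hd_inj: "inj_on hd (cover_vertices root)"
proof
  fix e e' assume e: "e \<in> cover_vertices root" "e' \<in> cover_vertices root" "hd e = hd e'"
  obtain n p where p: "p 0 = [root]" "p n = e" "\<forall>i<n. cover_adj root (p i) (p (Suc i))"
    using path_from_root[OF e(1)] by blast
  obtain m q where q: "q 0 = [root]" "q m = e'" "\<forall>i<m. cover_adj root (q i) (q (Suc i))"
    using path_from_root[OF e(2)] by blast
  define r where "r i = (if i \<le> n then p (n - i) else q (i - n))" for i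
  have "r (n + m) = r 0"
  proof (rule proj.closed_path_lifts_closed)
    show "simply_connected_space (geometric_realization X)" using systolic by (simp add: k_systolic_def)
    show "hd (r (n + m)) = hd (r 0)" using p q e(3) by (cases "m = 0") (auto simp: r_def)
    fix i assume i: "i < n + m"
    show "cover_adj root (r i) (r (Suc i))"
    proof (cases "i < n")
      case True
      then have "cover_adj root (p (n - Suc i)) (p (Suc (n - Suc i)))" using p(3) by simp
      moreover have "Suc (n - Suc i) = n - i" using True by simp
      ultimately show ?thesis using True cover.A_sym by (simp add: r_def)
    next
      case False
      then have "r i = q (i - n)" using p(1) q(1) by (auto simp: r_def)
      moreover have "r (Suc i) = q (Suc (i - n))" using False by (simp add: r_def Suc_diff_le)
      ultimately show ?thesis using q(3) i False by simp
    qed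
  qed
  then show "e = e'" using p q by (cases "m = 0") (auto simp: r_def)
qed

lemma hd_image: "hd ` cover_vertices root = \<Union>X"
proof (rule connected_edge_closed[OF complex])
  show "connected_space (geometric_realization X)" using systolic by (simp add: k_systolic_def)
  have hd_mem: "hd e \<in> \<Union>X" if e: "e \<in> cover_vertices root" for e
  proof (cases "length e = 1")
    case True
    then show ?thesis using cover.level_one[OF e] root by simp
  next
    case False
    then have "1 < length e" using cover.level_pos[OF e] by simp
    then obtain f where "cover_adj root e f" using cover.parent_exists[OF e] by blast
    then show ?thesis using edge_vertices cover.A_adj by blast
  qed
  then show "hd ` cover_vertices root \<subseteq> \<Union>X" by (rule image_subsetI)
  show "hd ` cover_vertices root \<noteq> {}" using cover.root_mem by auto
  fix x y assume x: "x \<in> hd ` cover_vertices root" and xy: "{x, y} \<in> X"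
  then obtain e where e: "e \<in> cover_vertices root" "x = hd e" by blast
  show "y \<in> hd ` cover_vertices root"
  proof (cases "x = y")
    case False
    then obtain f where "cover_adj root e f" "hd f = y" using proj.lift[of e y] e xy by blast
    then show ?thesis using cover.A_mem2[of e f] by (intro image_eqI[of _ _ f]) simp_all
  qed (use x in simp)
qed

definition lift :: "'v \<Rightarrow> 'v list" where "lift = inv_into (cover_vertices root) hd"

definition lev :: "'v \<Rightarrow> nat" where "lev x = length (lift x)"

lemma lift: "x \<in> \<Union>X \<Longrightarrow> lift x \<in> cover_vertices root \<and> hd (lift x) = x"
  using hd_image inv_into_into[of x hd] f_inv_into_f[of x hd] unfolding lift_def by metis

lemma lift_hd: "e \<in> cover_vertices root \<Longrightarrow> lift (hd e) = e"
  unfolding lift_def by (rule inv_into_f_f[OF hd_inj])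

lemma lift_adj: "edge_rel X x y \<Longrightarrow> cover_adj root (lift x) (lift y)"
proof -
  assume xy: "edge_rel X x y"
  then have "edge_rel X (hd (lift x)) y" using lift edge_vertices by metis
  then obtain f where "cover_adj root (lift x) f" "hd f = y"
    using cover.lift_exists lift edge_vertices[OF xy] by metis
  then show ?thesis using lift_hd cover.A_mem2 by metis
qed

text \<open>\<open>hd\<close> is now a bijection that preserves adjacency
  (\<open>cover.A_adj\<close>) and reflects it (\<open>lift_adj\<close>), so the properties of the
  cover carry over.\<close>

lemma leveled_graph:
  assumes "\<And>x. finite {y. edge_rel X x y}"
  shows "leveled_graph (edge_rel X) (\<Union>X) lev"
proof
  show "edge_rel X x y \<Longrightarrow> edge_rel X y x" for x y by (rule adj_sym)
  show "\<not> edge_rel X x x" for x by (rule adj_irrefl)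
  show "edge_rel X x y \<Longrightarrow> x \<in> \<Union>X" for x y using edge_vertices by blast
  show "edge_rel X x y \<Longrightarrow> lev y \<le> Suc (lev x)" for x y
    unfolding lev_def by (rule cover.A_level[OF lift_adj])
  show "x \<in> \<Union>X \<Longrightarrow> 1 \<le> lev x" for x
    unfolding lev_def by (rule cover.level_pos) (simp add: lift)
  show "finite {y. edge_rel X x y}" for x by (rule assms)
  show "p = q \<or> edge_rel X p q"
    if "edge_rel X x p" "edge_rel X x q" "lev x = Suc (lev p)" "lev x = Suc (lev q)" for x p q
  proof -
    have "lift p = lift q \<or> cover_adj root (lift p) (lift q)"
      using cover.parents_clique[OF lift_adj lift_adj, OF that(1,2)] that(3,4) by (simp add: lev_def)
    then show ?thesis
      using cover.A_adj[of "lift p" "lift q"] lift[of p] lift[of q]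
        edge_vertices[OF that(1)] edge_vertices[OF that(2)] by metis
  qed
  show "\<exists>p. lev p = n \<and> (\<forall>x\<in>S. edge_rel X x p)"
    if S: "finite S" "S \<noteq> {}" "S \<subseteq> \<Union>X" "\<And>x. x \<in> S \<Longrightarrow> lev x = Suc n" "1 \<le> n"
      "\<And>x y. \<lbrakk>x \<in> S; y \<in> S; x \<noteq> y\<rbrakk> \<Longrightarrow> edge_rel X x y" for S n
  proof -
    have "\<exists>p. length p = n \<and> (\<forall>e\<in>lift ` S. cover_adj root e p)"
    proof (rule cover.clique_common_parent)
      show "lift ` S \<subseteq> cover_vertices root" using lift S(3) by blast
      show "cover_adj root e f" if ef: "e \<in> lift ` S" "f \<in> lift ` S" "e \<noteq> f" for e f
      proof -
        obtain x y where "x \<in> S" "y \<in> S" "e = lift x" "f = lift y" using ef by blast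
        then show ?thesis using lift_adj[OF S(6), of x y] ef(3) by auto
      qed
    qed (use S in \<open>auto simp: lev_def\<close>)
    then obtain p where p: "length p = n" "\<And>x. x \<in> S \<Longrightarrow> cover_adj root (lift x) p" by blast
    obtain x0 where "x0 \<in> S" using S(2) by blast
    then have "lift (hd p) = p" using lift_hd cover.A_mem2 p(2) by blast
    moreover have "edge_rel X x (hd p)" if "x \<in> S" for x
    proof -
      have "hd (lift x) = x" using lift S(3) that by blast
      then show ?thesis using cover.A_adj[OF p(2)[OF that]] by simp
    qed
    ultimately show ?thesis using p(1) by (intro exI[of _ "hd p"]) (simp add: lev_def)
  qed
qed

lemma level_one: "{x \<in> \<Union>X. lev x = 1} \<subseteq> {root}"
proof
  fix x assume "x \<in> {x \<in> \<Union>X. lev x = 1}"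
  then have x: "x \<in> \<Union>X" "length (lift x) = 1" by (simp_all add: lev_def)
  then have "lift x = [root]" using cover.level_one[of "lift x"] lift[OF x(1)] by blast
  then show "x \<in> {root}" using lift[OF x(1)] by simp
qed

end

theorem theorem7p4:
  fixes G :: "('g, 'm) monoid_scheme"
    and X :: "'v set set"
    and \<phi> :: "'g \<Rightarrow> 'v \<Rightarrow> 'v"
  assumes "finitely_generated_group G"
    and "infinite (carrier G)"
    and "systolic X"
    and "simplicial_action G X \<phi>"
    and "proper_action G (geometric_realization X) (\<lambda>g. affine_extension (\<phi> g))"
    and "cocompact_action G (geometric_realization X) (\<lambda>g. affine_extension (\<phi> g))"
  shows "\<exists>g\<in>carrier G. \<forall>n::nat. n > 0 \<longrightarrow> g [^]\<^bsub>G\<^esub> n \<noteq> \<one>\<^bsub>G\<^esub>"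
proof -
  interpret systolic_complex X by unfold_locales (rule assms(3))
  interpret geometric_action G X \<phi> by (rule geometric_action.intro[OF complex assms(4-6)])
  interpret leveled_graph "edge_rel X" "\<Union>X" lev by (rule leveled_graph[OF finite_neighbors])
  interpret group G using group_hom group_hom.axioms(1) by blast
  have id: "\<phi> \<one>\<^bsub>G\<^esub> x = x" if "x \<in> \<Union>X" for x using fun_cong[OF id_eq_one, of x] that by simp
  obtain F where F: "finite F" "F \<subseteq> \<Union>X" "\<forall>v\<in>\<Union>X. \<exists>g\<in>carrier G. \<exists>u\<in>F. v = \<phi> g u"
    using finite_vertex_representatives by (elim exE conjE) (rule that)
  \<comment> \<open>Once a vertex of \<open>\<sigma> k\<close> has been moved into \<open>F\<close>,
    both \<open>\<sigma> k\<close> and \<open>\<sigma> (Suc k)\<close> lie in this set, being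
    contained in the closed neighbourhood of that vertex.\<close>
  define W where "W = (\<Union>u\<in>F. insert u {y. edge_rel X u y})"
  have "finite W" unfolding W_def using F(1) finite_neighbors by (intro finite_UN_I) auto
  then have finW: "finite (Pow W \<times> Pow W)" by simp
  have "X \<noteq> {}" using assms(3) by (simp add: k_systolic_def)
  then have inf_V: "infinite (\<Union>X)" by (rule infinite_vertices[OF assms(2)])
  have fin_1: "finite {x \<in> \<Union>X. lev x = 1}" by (rule finite_subset[OF level_one]) simp
  \<comment> \<open>The positions available for the pigeonhole argument are \<open>{1..<N}\<close>,
    one fewer than \<open>N\<close>; hence the summand 1.\<close>
  obtain v where v: "v \<in> \<Union>X" "card (Pow W \<times> Pow W) + 1 < lev v"
    using unbounded_levels[OF inf_V fin_1, of "card (Pow W \<times> Pow W) + 1"] by (elim bexE) (rule that)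
  define N where "N = lev v"
  obtain \<sigma> where \<sigma>: "geodesic N \<sigma>" unfolding N_def by (rule geodesic_exists[OF v(1)])
  have clique: "clique (\<sigma> k)" if "1 \<le> k" "k \<le> N" for k using \<sigma> that by (simp add: geodesic_def)
  have "\<exists>g\<in>carrier G. \<phi> (inv\<^bsub>G\<^esub> g) ` \<sigma> k \<subseteq> W \<and> \<phi> (inv\<^bsub>G\<^esub> g) ` \<sigma> (Suc k) \<subseteq> W"
    if k: "1 \<le> k" "k < N" for k
  proof -
    have c: "clique (\<sigma> k)" "clique (\<sigma> (Suc k))" using clique k by simp_all
    have V: "\<sigma> k \<subseteq> \<Union>X" "\<sigma> (Suc k) \<subseteq> \<Union>X" using c by (simp_all add: clique_def)
    obtain x where x: "x \<in> \<sigma> k" using c(1) by (auto simp: clique_def)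
    have "x \<in> \<Union>X" using V(1) x by (rule subsetD)
    then obtain g u where g: "g \<in> carrier G" "u \<in> F" "x = \<phi> g u" using F(3) by blast
    have uV: "u \<in> \<Union>X" using F(2) g(2) by (rule subsetD)
    have ig: "inv\<^bsub>G\<^esub> g \<in> carrier G" using g(1) by simp
    have gx: "\<phi> (inv\<^bsub>G\<^esub> g) x = u"
      using composition_rule[OF uV ig g(1)] g id[OF uV] by simp
    have inW: "\<phi> (inv\<^bsub>G\<^esub> g) y \<in> W" if y: "y \<in> \<Union>X" "y = x \<or> edge_rel X x y" for y
    proof -
      have "\<phi> (inv\<^bsub>G\<^esub> g) y = u \<or> edge_rel X u (\<phi> (inv\<^bsub>G\<^esub> g) y)"
        using y(2) gx edge_rel_image[OF ig \<open>x \<in> \<Union>X\<close> y(1)] by auto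
      then show ?thesis using g(2) unfolding W_def by blast
    qed
    have near: "y = x \<or> edge_rel X x y" if "y \<in> \<sigma> k" for y
      using c(1) x that by (auto simp: clique_def)
    have above: "edge_rel X x y" if "y \<in> \<sigma> (Suc k)" for y
    proof -
      have "\<sigma> k = parents k (\<sigma> (Suc k))" using \<sigma> k by (simp add: geodesic_def)
      then have "edge_rel X y x" using x that by (simp add: parents_def)
      then show ?thesis by (rule adj_sym)
    qed
    show ?thesis
      using inW near above subsetD[OF V(1)] subsetD[OF V(2)]
      by (intro bexI[OF _ g(1)] conjI image_subsetI) simp_all
  qed
  then obtain g where g: "\<And>k. 1 \<le> k \<Longrightarrow> k < N \<Longrightarrow> g k \<in> carrier G \<and>
      \<phi> (inv\<^bsub>G\<^esub> (g k)) ` \<sigma> k \<subseteq> W \<and> \<phi> (inv\<^bsub>G\<^esub> (g k)) ` \<sigma> (Suc k) \<subseteq> W" by metis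
  define c where "c k = (\<phi> (inv\<^bsub>G\<^esub> (g k)) ` \<sigma> k, \<phi> (inv\<^bsub>G\<^esub> (g k)) ` \<sigma> (Suc k))" for k
  have "c ` {1..<N} \<subseteq> Pow W \<times> Pow W"
  proof (rule image_subsetI)
    fix k assume "k \<in> {1..<N}"
    then have "1 \<le> k" "k < N" by simp_all
    from g[OF this] show "c k \<in> Pow W \<times> Pow W"
      unfolding c_def by (elim conjE) (intro SigmaI PowI)
  qed
  moreover have "card (Pow W \<times> Pow W) < card {1..<N}" using v(2) by (simp add: N_def)
  ultimately have "\<not> inj_on c {1..<N}" using card_inj_on_le[OF _ _ finW] by (metis not_le)
  then obtain i j where ij: "1 \<le> i" "i < j" "j < N" "c i = c j"
    unfolding inj_on_def by (metis atLeastLessThan_iff nat_neq_iff)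
  \<comment> \<open>From position \<open>i\<close> back into \<open>W\<close>, then out to position
    \<open>j\<close>.\<close>
  define a where "a = g j \<otimes>\<^bsub>G\<^esub> inv\<^bsub>G\<^esub> (g i)"
  have gij: "g i \<in> carrier G" "g j \<in> carrier G" using g ij by simp_all
  then have a: "a \<in> carrier G" by (simp add: a_def)
  have move: "\<phi> a ` S = T"
    if ST: "S \<subseteq> \<Union>X" "T \<subseteq> \<Union>X" "\<phi> (inv\<^bsub>G\<^esub> (g i)) ` S = \<phi> (inv\<^bsub>G\<^esub> (g j)) ` T" for S T
  proof -
    have "\<phi> a x = \<phi> (g j) (\<phi> (inv\<^bsub>G\<^esub> (g i)) x)" if "x \<in> S" for x
      unfolding a_def using composition_rule[OF subsetD[OF ST(1) that] gij(2)] gij(1) by simp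
    then have "\<phi> a ` S = \<phi> (g j) ` \<phi> (inv\<^bsub>G\<^esub> (g i)) ` S"
      unfolding image_image by (intro image_cong refl)
    also have "\<dots> = (\<lambda>x. \<phi> (g j) (\<phi> (inv\<^bsub>G\<^esub> (g j)) x)) ` T" by (simp add: ST(3) image_image)
    also have "\<dots> = (\<lambda>x. x) ` T"
    proof (rule image_cong[OF refl])
      fix x assume "x \<in> T"
      then have x: "x \<in> \<Union>X" using ST(2) by blast
      show "\<phi> (g j) (\<phi> (inv\<^bsub>G\<^esub> (g j)) x) = x"
        using composition_rule[OF x gij(2), of "inv\<^bsub>G\<^esub> (g j)"] gij(2) id[OF x] by simp
    qed
    finally show ?thesis by simp
  qed
  have sub: "\<sigma> k \<subseteq> \<Union>X" if "1 \<le> k" "k \<le> N" for k using clique[OF that] by (simp add: clique_def)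
  have auto_a: "edge_rel X (\<phi> a x) (\<phi> a y) \<longleftrightarrow> edge_rel X x y" if "x \<in> \<Union>X" "y \<in> \<Union>X" for x y
    by (rule edge_rel_image[OF a that])
  have shift: "\<phi> a ` \<sigma> i = \<sigma> j" "\<phi> a ` \<sigma> (Suc i) = \<sigma> (Suc j)"
    by (rule move[OF sub sub]; use ij in \<open>simp add: c_def\<close>)+
  have "a [^]\<^bsub>G\<^esub> n \<noteq> \<one>\<^bsub>G\<^esub>" if n: "0 < n" for n :: nat
  proof
    assume eq: "a [^]\<^bsub>G\<^esub> n = \<one>\<^bsub>G\<^esub>"
    have "\<exists>x\<in>\<Union>X. (\<phi> a ^^ n) x \<noteq> x"
      by (rule periodic_geodesic_escapes[OF bij[OF a] _ \<sigma> ij(1-3) shift n]) (rule auto_a)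
    then obtain x where x: "x \<in> \<Union>X" "(\<phi> a ^^ n) x \<noteq> x" by (elim bexE) (rule that)
    then show False using action_pow[OF a x(1), of n] eq id[OF x(1)] by simp
  qed
  then show ?thesis using a by blast
qed

end
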